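(* 1. The ordering $\langle\mathcal P(\kappa),\subset\rangle$ can be embedded into $\langle\mathcal E^B_\kappa,\le_B\rangle$. 2. Assume that $\kappa=\omega_1$ and $\diamondsuit_{\omega_1}$ holds, or that $\kappa$ is not a successor of an $\omega$-cofinal cardinal. Then also the ordering $\langle\mathcal P(\kappa),\subset_*\rangle$ can be embedded into $\langle\mathcal E^B_\kappa,\le_B\rangle$, where $\subset_*$ is inclusion modulo bounded sets.
   Context: Throughout, $\kappa$ is an uncountable regular cardinal with $\kappa^{<\kappa}=\kappa$ (i.e. $|\kappa^\alpha|=\kappa$ for all $0<\alpha<\kappa$). The space $2^\kappa$ of all functions $\kappa\to\{0,1\}$ carries the topology generated by the sets $N_p=\{\eta\in 2^\kappa\mid \eta\restriction\alpha=p\}$ for $\alpha<\kappa$, $p\in 2^\alpha$. Borel sets are obtained by closing the topology under unions and intersections of length $\le\kappa$ and complements (likewise for $(2^\kappa)^2$ with the product topology). A function is Borel if inverse images of open sets are Borel. For equivalence relations $E,E'$ on $2^\kappa$, $E\le_B E'$ means that there is a Borel function $f\colon 2^\kappa\to2^\kappa$ with $(\eta,\xi)\in E\iff(f(\eta),f(\xi))\in E'$ for all $\eta,\xi$. $\mathcal E^B_\kappa$ is the set of equivalence relations on $2^\kappa$ that are Borel subsets of $(2^\kappa)^2$. $A\subset_*B$ means that $A\setminus B$ is bounded in $\kappa$. For an ordering $\preceq$ on $\mathcal P(\kappa)$, an embedding of $\langle\mathcal P(\kappa),\preceq\rangle$ into $\langle\mathcal E^B_\kappa,\le_B\rangle$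 is a map $F\colon\mathcal P(\kappa)\to\mathcal E^B_\kappa$ with $X\preceq Y\iff F(X)\le_B F(Y)$ for all $X,Y\subset\kappa$ (quasiorders being regarded as partial orders modulo the induced equivalence relation). For $S\subset\kappa$, $\diamondsuit_\kappa(S)$ states that there exists a sequence $\langle D_\alpha\mid\alpha\in S\rangle$ such that for every $A\subset\kappa$ the set $\{\alpha\in S\mid A\cap\alpha=D_\alpha\}$ is stationary; $\diamondsuit_{\omega_1}$ is $\diamondsuit_{\omega_1}(\omega_1)$. *)

theory Defs
  imports "HOL-Analysis.Analysis"
begin

unbundle cardinal_syntax

text \<open>
  The cardinal \<open>\<kappa>\<close> is an initial well-order (\<open>card_order\<close>) on a type \<open>'k\<close>, whose elements play the
  role of the ordinals below \<open>\<kappa>\<close>; the ordinal \<open>\<alpha>\<close>, as the set of its predecessors, is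
  \<open>underS \<kappa> \<alpha>\<close>. The set \<open>2\<^sup>\<kappa>\<close> is the type \<open>'k \<Rightarrow> bool\<close>, and the power set of \<open>\<kappa>\<close> is \<open>'k set\<close>.
\<close>

definition unctbl_regular_pow_cardinal :: "'k rel \<Rightarrow> bool" where
  "unctbl_regular_pow_cardinal \<kappa> \<longleftrightarrow>
     card_order \<kappa> \<and> natLeq <o \<kappa> \<and> regularCard \<kappa> \<and>
     (\<forall>\<alpha>. underS \<kappa> \<alpha> \<noteq> {} \<longrightarrow> \<kappa> ^c |underS \<kappa> \<alpha>| =o \<kappa>)"

text \<open>
  A condition \<open>p\<close> in \<open>2\<^sup>\<alpha>\<close> is given by any total function that extends it.
\<close>

definition basic_nbhd :: "'k rel \<Rightarrow> 'k \<Rightarrow> ('k \<Rightarrow> bool) \<Rightarrow> ('k \<Rightarrow> bool) set" where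
  "basic_nbhd \<kappa> \<alpha> p = {\<eta>. \<forall>\<beta>\<in>underS \<kappa> \<alpha>. \<eta> \<beta> = p \<beta>}"

definition cantor_topology :: "'k rel \<Rightarrow> ('k \<Rightarrow> bool) topology" where
  "cantor_topology \<kappa> = topology_generated_by {basic_nbhd \<kappa> \<alpha> p |\<alpha> p. True}"

inductive_set kappa_borel :: "'k rel \<Rightarrow> 'a topology \<Rightarrow> 'a set set"
  for \<kappa> :: "'k rel" and T :: "'a topology" where
  "open": "openin T U \<Longrightarrow> U \<in> kappa_borel \<kappa> T"
| compl: "A \<in> kappa_borel \<kappa> T \<Longrightarrow> topspace T - A \<in> kappa_borel \<kappa> T"
| union: "(\<And>A. A \<in> \<A> \<Longrightarrow> A \<in> kappa_borel \<kappa> T) \<Longrightarrow> |\<A>| \<le>o \<kappa> \<Longrightarrow> \<Union>\<A> \<in> kappa_borel \<kappa> T"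
| inter: "(\<And>A. A \<in> \<A> \<Longrightarrow> A \<in> kappa_borel \<kappa> T) \<Longrightarrow> |\<A>| \<le>o \<kappa> \<Longrightarrow> \<A> \<noteq> {} \<Longrightarrow> \<Inter>\<A> \<in> kappa_borel \<kappa> T"

definition borel_function :: "'k rel \<Rightarrow> (('k \<Rightarrow> bool) \<Rightarrow> ('k \<Rightarrow> bool)) \<Rightarrow> bool" where
  "borel_function \<kappa> f \<longleftrightarrow>
     (\<forall>U. openin (cantor_topology \<kappa>) U \<longrightarrow> f -` U \<in> kappa_borel \<kappa> (cantor_topology \<kappa>))"

definition borel_equivs :: "'k rel \<Rightarrow> ('k \<Rightarrow> bool) rel set" where
  "borel_equivs \<kappa> =
     {E. equiv UNIV E \<and> E \<in> kappa_borel \<kappa> (prod_topology (cantor_topology \<kappa>) (cantor_topology \<kappa>))}"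

definition borel_reducible :: "'k rel \<Rightarrow> ('k \<Rightarrow> bool) rel \<Rightarrow> ('k \<Rightarrow> bool) rel \<Rightarrow> bool" where
  "borel_reducible \<kappa> E E' \<longleftrightarrow>
     (\<exists>f. borel_function \<kappa> f \<and> (\<forall>\<eta> \<xi>. (\<eta>, \<xi>) \<in> E \<longleftrightarrow> (f \<eta>, f \<xi>) \<in> E'))"

definition embeds_into_borel_equivs :: "'k rel \<Rightarrow> ('k set \<Rightarrow> 'k set \<Rightarrow> bool) \<Rightarrow> bool" where
  "embeds_into_borel_equivs \<kappa> le \<longleftrightarrow>
     (\<exists>F. (\<forall>X. F X \<in> borel_equivs \<kappa>) \<and> (\<forall>X Y. le X Y \<longleftrightarrow> borel_reducible \<kappa> (F X) (F Y)))"

definition subset_mod_bounded :: "'k rel \<Rightarrow> 'k set \<Rightarrow> 'k set \<Rightarrow> bool" where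
  "subset_mod_bounded \<kappa> A B \<longleftrightarrow> (\<exists>\<alpha>. A - B \<subseteq> underS \<kappa> \<alpha>)"

text \<open>
  In the closure clause the strict inequality forces \<open>\<alpha>\<close> to be a limit.
\<close>

definition club :: "'k rel \<Rightarrow> 'k set \<Rightarrow> bool" where
  "club \<kappa> C \<longleftrightarrow> cofinal C \<kappa> \<and>
     (\<forall>\<alpha>. underS \<kappa> \<alpha> \<noteq> {} \<and> (\<forall>\<beta>\<in>underS \<kappa> \<alpha>. \<exists>\<gamma>\<in>C \<inter> underS \<kappa> \<alpha>. \<beta> \<in> underS \<kappa> \<gamma>) \<longrightarrow> \<alpha> \<in> C)"

definition stationary :: "'k rel \<Rightarrow> 'k set \<Rightarrow> bool" where
  "stationary \<kappa> S \<longleftrightarrow> (\<forall>C. club \<kappa> C \<longrightarrow> S \<inter> C \<noteq> {})"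

definition diamond :: "'k rel \<Rightarrow> 'k set \<Rightarrow> bool" where
  "diamond \<kappa> S \<longleftrightarrow>
     (\<exists>D :: 'k \<Rightarrow> 'k set. \<forall>A. stationary \<kappa> {\<alpha> \<in> S. A \<inter> underS \<kappa> \<alpha> = D \<alpha>})"

definition has_cofinality :: "'a rel \<Rightarrow> 'b rel \<Rightarrow> bool" where
  "has_cofinality r c \<longleftrightarrow>
     (\<exists>A \<subseteq> Field r. cofinal A r \<and> |A| =o c) \<and>
     (\<forall>A \<subseteq> Field r. cofinal A r \<longrightarrow> c \<le>o |A| )"

text \<open>
  Since \<open>\<mu> <o cardSuc \<mu>\<close>, every cardinal of which \<open>\<kappa>\<close> is the successor is represented on a subset
  of the type \<open>'k\<close>, so it suffices to let \<open>\<mu>\<close> range over \<open>'k rel\<close>.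
\<close>

definition succ_of_omega_cofinal :: "'k rel \<Rightarrow> bool" where
  "succ_of_omega_cofinal \<kappa> \<longleftrightarrow>
     (\<exists>\<mu> :: 'k rel. Card_order \<mu> \<and> has_cofinality \<mu> natLeq \<and> \<kappa> =o cardSuc \<mu>)"

end

theory Submission
  imports Defs
begin

text \<open>
  The first part follows from the second because \<open>X \<mapsto> X \<times> \<kappa>\<close>, read in \<open>\<kappa> \<times> \<kappa> \<cong> \<kappa>\<close>, turns inclusion
  into inclusion modulo bounded sets.

  Fix disjoint stationary sets \<open>S\<^sub>m\<close>, \<open>m < \<kappa>\<close>, of \<open>\<omega>\<close>-cofinal points. A point of \<open>2\<^sup>\<kappa>\<close> is read as a pair
  \<open>(t, u)\<close> of \<open>\<kappa> \<times> \<kappa>\<close> matrices. Put \<open>(t, u) E\<^sub>X (t', u')\<close> if each row of \<open>t\<close> differs from that of \<open>t'\<close> on a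
  bounded set and, for some \<open>k\<close> and all \<open>m \<ge> k\<close>, the \<open>m\<close>-th rows of \<open>u\<close> and \<open>u'\<close> agree and, if \<open>m \<notin> X\<close>, below each point
  of \<open>S\<^sub>m\<close> each row of \<open>t\<close> is eventually equal, or eventually opposite, to that of \<open>t'\<close>. If \<open>X - Y\<close> is bounded, then
  adding to \<open>u\<close> codes for the local classes at \<open>S\<^sub>m\<close>, \<open>m \<notin> X\<close>, reduces \<open>E\<^sub>X\<close> to \<open>E\<^sub>Y\<close>.

  Now let \<open>X - Y\<close> be unbounded and let \<open>f\<close> be a Borel reduction; it is continuous on a comeager set. If for
  every \<open>\<beta>\<close> admissible changes in fresh rows could destroy the local clauses of \<open>E\<^sub>Y\<close> for some \<open>m \<ge> \<beta>\<close>, then \<open>\<kappa>\<close>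
  many such changes, each in its own row, would give equivalent points with inequivalent images. Hence from
  some condition on, with some \<open>\<beta>\<close>, such changes no longer hurt. Take \<open>i \<in> X - Y\<close> with \<open>i \<ge> \<beta>\<close> and a fresh row. If
  some row of the image were nowhere insensitive to late changes of that row, then in \<open>\<omega>\<close> steps one could
  make the images both agree and disagree cofinally below a point of \<open>S\<^sub>i\<close>, contrary to the choice of \<open>\<beta>\<close>. So
  late changes are invisible in each row of the image, and flipping the row entirely, which leads to an
  inequivalent point, yields equivalent images.
\<close>

no_notation (input) elt_set_eq (infix "=o" 50)

subsection \<open>The order of \<open>\<kappa>\<close>\<close>

locale kappa =
  fixes \<kappa> :: "'k rel"
  assumes unctbl_regular: "unctbl_regular_pow_cardinal \<kappa>"
begin

abbreviation le (infix "\<sqsubseteq>" 50) where "x \<sqsubseteq> y \<equiv> (x, y) \<in> \<kappa>"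
abbreviation lt (infix "\<sqsubset>" 50) where "x \<sqsubset> y \<equiv> x \<in> underS \<kappa> y"

lemma card_order: "card_order \<kappa>" and uncountable: "natLeq <o \<kappa>" and regular: "regularCard \<kappa>"
  and pow: "underS \<kappa> \<alpha> \<noteq> {} \<Longrightarrow> \<kappa> ^c |underS \<kappa> \<alpha>| =o \<kappa>"
  using unctbl_regular by (auto simp: unctbl_regular_pow_cardinal_def)

lemma Field_UNIV [simp]: "Field \<kappa> = UNIV"
  using card_order by (simp add: Field_card_order)

lemma Card_order: "Card_order \<kappa>"
  using card_order by (simp add: card_order_on_Card_order)

lemma well_order: "well_order \<kappa>"
  using card_order by (simp add: card_order_on_def)

lemma card_UNIV: "|UNIV :: 'k set| =o \<kappa>"
  using card_of_Field_ordIso[OF Card_order] by simp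

lemma lt_iff: "x \<sqsubset> y \<longleftrightarrow> x \<sqsubseteq> y \<and> x \<noteq> y"
  by (auto simp: underS_def)

sublocale O: wellorder le lt
proof
  have lin: "linear_order \<kappa>" using well_order by (simp add: well_order_on_def)
  have po: "trans \<kappa>" "antisym \<kappa>" "refl \<kappa>" "total \<kappa>"
    using lin by (auto simp: linear_order_on_def partial_order_on_def preorder_on_def)
  show "x \<sqsubseteq> x" for x using po(3) by (auto simp: refl_on_def)
  show "x \<sqsubseteq> z" if "x \<sqsubseteq> y" "y \<sqsubseteq> z" for x y z using that po(1) by (blast dest: transD)
  show "x = y" if "x \<sqsubseteq> y" "y \<sqsubseteq> x" for x y using that po(2) by (blast dest: antisymD)
  then show "x \<sqsubset> y \<longleftrightarrow> x \<sqsubseteq> y \<and> \<not> y \<sqsubseteq> x" for x y by (auto simp: lt_iff \<open>\<And>x. x \<sqsubseteq> x\<close>)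
  show "x \<sqsubseteq> y \<or> y \<sqsubseteq> x" for x y
    using po(3,4) by (cases "x = y") (auto simp: refl_on_def total_on_def)
  show "P a" if "\<And>x. (\<And>y. y \<sqsubset> x \<Longrightarrow> P y) \<Longrightarrow> P x" for P a
  proof -
    have "wf (\<kappa> - Id)" using well_order by (simp add: well_order_on_def)
    then show ?thesis
      by (induction a rule: wf_induct_rule) (auto intro: that simp: lt_iff)
  qed
qed

lemma wf_lt: "wf {(x, y). x \<sqsubset> y}"
proof -
  have "{(x, y). x \<sqsubset> y} = \<kappa> - Id" by (auto simp: lt_iff)
  then show ?thesis using well_order by (simp add: well_order_on_def)
qed

lemma infinite_UNIV: "infinite (UNIV :: 'k set)"
proof
  assume "finite (UNIV :: 'k set)"
  then have "|UNIV :: 'k set| <o natLeq"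
    by (simp add: finite_iff_ordLess_natLeq[symmetric])
  then show False
    using uncountable card_UNIV by (meson not_ordLess_ordLeq ordIso_ordLess_trans ordIso_symmetric ordLess_imp_ordLeq)
qed

section \<open>Bounded sets: by regularity, the sets of size less than \<kappa>\<close>

definition bdd :: "'k set \<Rightarrow> bool" where "bdd A \<longleftrightarrow> (\<exists>b. \<forall>x\<in>A. x \<sqsubset> b)"

lemma ex_gt: "\<exists>y. x \<sqsubset> y"
  using infinite_Card_order_limit[OF Card_order, of x] infinite_UNIV by (auto simp: lt_iff)

lemma ex_ge2: "\<exists>z. x \<sqsubset> z \<and> y \<sqsubset> z"
  by (metis ex_gt O.less_trans O.linear O.le_less_trans)

lemma small_bdd: assumes "|A| <o \<kappa>" shows "bdd A"
proof -
  have "\<not> cofinal A \<kappa>" using regular assms unfolding regularCard_def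
    by (metis Field_UNIV not_ordLess_ordIso subset_UNIV)
  then obtain a where "\<forall>b\<in>A. b \<sqsubseteq> a" unfolding cofinal_def
    by (metis O.linear O.order.refl)
  then show ?thesis unfolding bdd_def using ex_gt[of a] O.le_less_trans by blast
qed

lemma bdd_small: "bdd A \<Longrightarrow> |A| <o \<kappa>"
  unfolding bdd_def
  by (metis Card_order Field_UNIV UNIV_I card_of_mono1 card_of_underS ordLeq_ordLess_trans subsetI)

lemma bdd_iff_small: "bdd A \<longleftrightarrow> |A| <o \<kappa>"
  using small_bdd bdd_small by blast

lemma bdd_subset: "bdd B \<Longrightarrow> A \<subseteq> B \<Longrightarrow> bdd A"
  unfolding bdd_def by blast

lemma bdd_underS: "bdd (underS \<kappa> a)" "bdd {x. x \<sqsubset> a}"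
  unfolding bdd_def by auto

lemma bdd_image: "bdd A \<Longrightarrow> bdd (f ` A)"
  unfolding bdd_iff_small using card_of_image ordLeq_ordLess_trans by blast

text \<open>The bounds chosen for the individual sets form a bounded set themselves, and a bound of
  that set dominates the whole union.\<close>

lemma bdd_UN: assumes "bdd A" "\<And>a. a \<in> A \<Longrightarrow> bdd (F a)" shows "bdd (\<Union>a\<in>A. F a)"
proof -
  define g where "g a = (SOME b. \<forall>x\<in>F a. x \<sqsubset> b)" for a
  have g: "\<forall>x\<in>F a. x \<sqsubset> g a" if "a \<in> A" for a
    unfolding g_def using someI_ex[OF assms(2)[OF that, unfolded bdd_def]] .
  obtain b where "\<forall>x\<in>g ` A. x \<sqsubset> b" using bdd_image[OF assms(1)] unfolding bdd_def by blast
  then have "\<forall>x\<in>\<Union>a\<in>A. F a. x \<sqsubset> b" using g O.less_trans[of _ "g _" b] by blast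
  then show ?thesis unfolding bdd_def ..
qed

lemma bdd_Un: "bdd A \<Longrightarrow> bdd B \<Longrightarrow> bdd (A \<union> B)"
  unfolding bdd_iff_small using card_of_Un_ordLess_infinite_Field[OF _ Card_order] infinite_UNIV by simp

lemma bdd_range_nat: "bdd (range (g :: nat \<Rightarrow> 'k))"
proof (rule small_bdd)
  have "|range g| \<le>o natLeq" using card_of_image[of g UNIV] card_of_nat ordLeq_ordIso_trans by blast
  then show "|range g| <o \<kappa>" using uncountable ordLeq_ordLess_trans by blast
qed

text \<open>The range has size \<kappa>, while bounded sets are smaller. When a spare parameter is
  encoded along with an object, this supplies arbitrarily large codes for the object.\<close>

lemma inj_unbounded: assumes "inj (g :: 'k \<Rightarrow> 'k)" shows "\<exists>z. a \<sqsubset> g z"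
proof (rule ccontr)
  assume *: "\<nexists>z. a \<sqsubset> g z"
  obtain c where c: "a \<sqsubset> c" using ex_gt by blast
  have "bdd (range g)" unfolding bdd_def using * c O.not_less O.le_less_trans by blast
  then have "|range g| <o \<kappa>" by (rule bdd_small)
  moreover have "|range g| =o |UNIV :: 'k set|"
    using assms by (metis card_of_ordIso inj_on_imp_bij_betw ordIso_symmetric)
  ultimately show False
    using card_UNIV by (metis not_ordLess_ordIso ordIso_transitive)
qed

lemma card_prod_le:
  assumes "|UNIV :: 'a set| \<le>o \<kappa>" "|UNIV :: 'b set| \<le>o \<kappa>"
  shows "|UNIV :: ('a \<times> 'b) set| \<le>o \<kappa>"
  using card_of_Times_ordLeq_infinite_Field[OF _ assms Card_order] infinite_UNIV by simp

lemma card_le_iff_inj: "|UNIV :: 'a set| \<le>o \<kappa> \<longleftrightarrow> (\<exists>f :: 'a \<Rightarrow> 'k. inj f)"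
proof -
  have "|UNIV :: 'a set| \<le>o \<kappa> \<longleftrightarrow> |UNIV :: 'a set| \<le>o |UNIV :: 'k set|"
    using card_UNIV by (meson ordIso_symmetric ordLeq_ordIso_trans)
  also have "\<dots> \<longleftrightarrow> (\<exists>f :: 'a \<Rightarrow> 'k. inj f)" unfolding card_of_ordLeq[symmetric] by auto
  finally show ?thesis .
qed

lemma card_self: "|UNIV :: 'k set| \<le>o \<kappa>"
  using card_UNIV ordIso_imp_ordLeq by blast

lemma card_bool: "|UNIV :: bool set| \<le>o \<kappa>"
proof -
  obtain x y :: 'k where "x \<noteq> y" using ex_gt by (metis O.less_irrefl)
  then have "inj (\<lambda>b. if b then x else y)" by (auto simp: inj_def)
  then show ?thesis unfolding card_le_iff_inj by blast
qed

text \<open>This is the only use of the hypothesis on cardinal powers.\<close>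

lemma ex_enum_bdd: "\<exists>s :: 'k \<Rightarrow> 'k set. \<forall>h. bdd h \<longrightarrow> h \<in> range s"
proof -
  have 1: "|Pow (underS \<kappa> a)| \<le>o |UNIV :: 'k set|" for a
  proof (cases "underS \<kappa> a = {}")
    case True
    then show ?thesis using infinite_UNIV by (metis Pow_empty card_of_singl_ordLeq UNIV_not_empty)
  next
    case False
    obtain x y :: 'k where xy: "x \<noteq> y" using ex_gt by (metis O.less_irrefl)
    \<comment> \<open>Characteristic functions with the two values \<open>x\<close> and
      \<open>y\<close> embed the power set of the segment into the function space whose size the
      hypothesis computes. That hypothesis covers nonempty segments only, hence the case
      split.\<close>
    define F where "F A = (\<lambda>z. if z \<in> underS \<kappa> a then (if z \<in> A then x else y) else undefined)" for A
    have "inj_on F (Pow (underS \<kappa> a))"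
      unfolding inj_on_def F_def using xy by (auto simp: fun_eq_iff; metis)
    moreover have "F ` Pow (underS \<kappa> a) \<subseteq> Func (underS \<kappa> a) UNIV" by (auto simp: F_def Func_def)
    ultimately have "|Pow (underS \<kappa> a)| \<le>o |Func (underS \<kappa> a) (UNIV :: 'k set)|"
      using card_of_ordLeq by blast
    also have "|Func (underS \<kappa> a) (UNIV :: 'k set)| =o \<kappa>"
      using pow[OF False] by (simp add: cexp_def Field_card_of)
    finally show ?thesis using card_UNIV by (metis ordIso_symmetric ordLeq_ordIso_trans)
  qed
  have "|\<Union>a\<in>(UNIV :: 'k set). Pow (underS \<kappa> a)| \<le>o |UNIV :: 'k set|"
    by (rule card_of_UNION_ordLeq_infinite[OF infinite_UNIV card_of_mono1]) (use 1 in auto)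
  then obtain s where s: "s ` (UNIV :: 'k set) = (\<Union>a\<in>(UNIV :: 'k set). Pow (underS \<kappa> a))"
    using card_of_ordLeq2[of "\<Union>a\<in>(UNIV :: 'k set). Pow (underS \<kappa> a)" "UNIV :: 'k set"] by auto
  show ?thesis unfolding bdd_def by (rule exI[of _ s]) (auto simp: s)
qed

subsection \<open>Baire category\<close>

definition agree :: "'k \<Rightarrow> ('k \<Rightarrow> bool) \<Rightarrow> ('k \<Rightarrow> bool) \<Rightarrow> bool" where
  "agree \<delta> \<eta> \<xi> \<longleftrightarrow> (\<forall>x. x \<sqsubset> \<delta> \<longrightarrow> \<eta> x = \<xi> x)"

lemma agree_refl [simp]: "agree \<delta> \<eta> \<eta>"
  and agree_sym: "agree \<delta> \<eta> \<xi> \<Longrightarrow> agree \<delta> \<xi> \<eta>"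
  and agree_trans: "agree \<delta> \<eta> \<xi> \<Longrightarrow> agree \<delta> \<xi> \<zeta> \<Longrightarrow> agree \<delta> \<eta> \<zeta>"
  unfolding agree_def by auto

lemma agree_mono: "agree \<delta> \<eta> \<xi> \<Longrightarrow> \<epsilon> \<sqsubseteq> \<delta> \<Longrightarrow> agree \<epsilon> \<eta> \<xi>"
  unfolding agree_def using O.less_le_trans by blast

lemma agree_mono_lt: "agree \<delta> \<eta> \<xi> \<Longrightarrow> \<epsilon> \<sqsubset> \<delta> \<Longrightarrow> agree \<epsilon> \<eta> \<xi>"
  using agree_mono O.less_imp_le by blast

abbreviation opn where "opn U \<equiv> openin (cantor_topology \<kappa>) U"

lemma mem_basic_nbhd: "\<xi> \<in> basic_nbhd \<kappa> \<delta> \<eta> \<longleftrightarrow> agree \<delta> \<eta> \<xi>"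
  unfolding basic_nbhd_def agree_def by auto

text \<open>The generating sets already form a base: two of them around a common point both contain
  the one around that point of a larger length.\<close>

lemma opn_iff: "opn U \<longleftrightarrow> (\<forall>\<eta>\<in>U. \<exists>\<delta>. \<forall>\<xi>. agree \<delta> \<eta> \<xi> \<longrightarrow> \<xi> \<in> U)"
proof
  assume "opn U"
  then have "generate_topology_on {basic_nbhd \<kappa> \<alpha> p |\<alpha> p. True} U"
    unfolding cantor_topology_def by (rule openin_topology_generated_by)
  then show "\<forall>\<eta>\<in>U. \<exists>\<delta>. \<forall>\<xi>. agree \<delta> \<eta> \<xi> \<longrightarrow> \<xi> \<in> U"
  proof induction
    case (Int a b)
    show ?case
    proof
      fix \<eta> assume "\<eta> \<in> a \<inter> b"
      then obtain d1 d2 where "\<forall>\<xi>. agree d1 \<eta> \<xi> \<longrightarrow> \<xi> \<in> a" "\<forall>\<xi>. agree d2 \<eta> \<xi> \<longrightarrow> \<xi> \<in> b"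
        using Int by blast
      moreover obtain d where "d1 \<sqsubset> d" "d2 \<sqsubset> d" using ex_ge2 by blast
      ultimately show "\<exists>\<delta>. \<forall>\<xi>. agree \<delta> \<eta> \<xi> \<longrightarrow> \<xi> \<in> a \<inter> b"
        by (metis IntI agree_mono_lt)
    qed
  next
    case (UN K)
    then show ?case by (meson Union_iff)
  next
    case (Basis s)
    then obtain \<alpha> p where "s = basic_nbhd \<kappa> \<alpha> p" by blast
    then show ?case by (metis mem_basic_nbhd agree_trans)
  qed auto
next
  assume *: "\<forall>\<eta>\<in>U. \<exists>\<delta>. \<forall>\<xi>. agree \<delta> \<eta> \<xi> \<longrightarrow> \<xi> \<in> U"
  have "U = \<Union>{basic_nbhd \<kappa> \<delta> \<eta> |\<delta> \<eta>. basic_nbhd \<kappa> \<delta> \<eta> \<subseteq> U}"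
  proof
    show "U \<subseteq> \<Union>{basic_nbhd \<kappa> \<delta> \<eta> |\<delta> \<eta>. basic_nbhd \<kappa> \<delta> \<eta> \<subseteq> U}"
    proof
      fix \<eta> assume "\<eta> \<in> U"
      then obtain \<delta> where "\<forall>\<xi>. agree \<delta> \<eta> \<xi> \<longrightarrow> \<xi> \<in> U" using * by blast
      then have "basic_nbhd \<kappa> \<delta> \<eta> \<subseteq> U" "\<eta> \<in> basic_nbhd \<kappa> \<delta> \<eta>" using mem_basic_nbhd by auto
      then show "\<eta> \<in> \<Union>{basic_nbhd \<kappa> \<delta> \<eta> |\<delta> \<eta>. basic_nbhd \<kappa> \<delta> \<eta> \<subseteq> U}" by blast
    qed
  qed blast
  also have "opn \<dots>"
    unfolding cantor_topology_def by (rule openin_Union) (auto intro: topology_generated_by_Basis)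
  finally show "opn U" .
qed

lemma opn_UNIV [simp]: "opn UNIV" unfolding opn_iff by auto

lemma topspace_cantor [simp]: "topspace (cantor_topology \<kappa>) = UNIV"
  using openin_subset[OF opn_UNIV] by auto

lemma opn_coord: "opn {\<eta>. \<eta> x = v}"
proof -
  obtain \<delta> where "x \<sqsubset> \<delta>" using ex_gt by blast
  then show ?thesis unfolding opn_iff agree_def by fastforce
qed

definition dns :: "('k \<Rightarrow> bool) set \<Rightarrow> bool" where
  "dns U \<longleftrightarrow> (\<forall>\<eta> \<delta>. \<exists>\<xi>\<in>U. agree \<delta> \<eta> \<xi>)"

definition comeager :: "('k \<Rightarrow> bool) set \<Rightarrow> bool" where
  "comeager A \<longleftrightarrow> (\<exists>D :: 'k \<Rightarrow> _. (\<forall>i. opn (D i) \<and> dns (D i)) \<and> (\<Inter>i. D i) \<subseteq> A)"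

lemma comeager_mono: "comeager A \<Longrightarrow> A \<subseteq> B \<Longrightarrow> comeager B"
  unfolding comeager_def by blast

lemma comeager_opn_dns: "opn U \<Longrightarrow> dns U \<Longrightarrow> comeager U"
  unfolding comeager_def by (rule exI[of _ "\<lambda>_. U"]) auto

lemma dns_UNIV: "dns UNIV"
  unfolding dns_def using agree_refl by blast

lemma comeager_UNIV: "comeager UNIV"
  by (rule comeager_opn_dns[OF opn_UNIV dns_UNIV])

lemma comeager_INT:
  assumes "\<And>k :: 'k. comeager (A k)"
  shows "comeager (\<Inter>k. A k)"
proof -
  obtain D where D: "\<And>k i. opn (D k i) \<and> dns (D k i)" "\<And>k. (\<Inter>i :: 'k. D k i) \<subseteq> A k"
    using assms unfolding comeager_def by metis
  obtain g :: "'k \<times> 'k \<Rightarrow> 'k" where g: "inj g"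
    using card_prod_le[OF card_self card_self] card_le_iff_inj by blast
  \<comment> \<open>The double family is reindexed along the injection \<open>g\<close>; indices
    outside its range contribute the whole space.\<close>
  define D' where "D' z = (if z \<in> range g then D (fst (inv g z)) (snd (inv g z)) else UNIV)" for z
  have "(\<Inter>z. D' z) \<subseteq> (\<Inter>k. A k)"
  proof
    fix \<eta> assume \<eta>: "\<eta> \<in> (\<Inter>z. D' z)"
    have "\<eta> \<in> D k i" for k i
      using INT_D[OF \<eta>, of "g (k, i)"] g by (simp add: D'_def)
    then show "\<eta> \<in> (\<Inter>k. A k)" using D(2) by blast
  qed
  moreover have "opn (D' z) \<and> dns (D' z)" for z
    using D(1) by (auto simp: D'_def dns_UNIV)
  ultimately show ?thesis unfolding comeager_def by blast
qed

lemma comeager_Int: assumes "comeager A" "comeager B" shows "comeager (A \<inter> B)"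
proof -
  obtain a b :: 'k where ab: "a \<noteq> b" using ex_gt by (metis O.less_irrefl)
  have "comeager (\<Inter>k. if k = a then A else B)" by (rule comeager_INT) (use assms in auto)
  then show ?thesis by (rule comeager_mono) (use ab in \<open>auto split: if_splits; metis\<close>)
qed

text \<open>A chain of conditions of length \<kappa> whose \<open>i\<close>-th member meets the
  \<open>i\<close>-th requirement. \<open>closed\<close> bounds the members chosen so far and
  \<open>dense\<close> then meets the requirement. Used for the Baire category theorem and, with
  more elaborate conditions, in \<open>ex_settled\<close>.\<close>

lemma generic_chain:
  fixes R :: "'s \<Rightarrow> 's \<Rightarrow> bool" and P :: "'s set" and Q :: "'k \<Rightarrow> 's \<Rightarrow> bool"
  assumes trans: "\<And>a b c. R a b \<Longrightarrow> R b c \<Longrightarrow> R a c"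
    and closed: "\<And>i p. (\<And>j. j \<sqsubset> i \<Longrightarrow> p j \<in> P) \<Longrightarrow> (\<And>j j'. j \<sqsubset> j' \<Longrightarrow> j' \<sqsubset> i \<Longrightarrow> R (p j) (p j')) \<Longrightarrow>
      \<exists>j. j \<sqsubset> i \<Longrightarrow> \<exists>q\<in>P. \<forall>j. j \<sqsubset> i \<longrightarrow> R (p j) q"
    and dense: "\<And>i q. q \<in> P \<Longrightarrow> \<exists>q'\<in>P. R q q' \<and> Q i q'"
    and s0: "s0 \<in> P"
  obtains p where "\<And>i. p i \<in> P" "\<And>i. Q i (p i)" "\<And>i. R s0 (p i)" "\<And>i j. j \<sqsubset> i \<Longrightarrow> R (p j) (p i)"
proof -
  define G where "G f i q \<longleftrightarrow> q \<in> P \<and> R s0 q \<and> Q i q \<and> (\<forall>j. j \<sqsubset> i \<longrightarrow> R (f j) q)"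
    for f :: "'k \<Rightarrow> 's" and i q
  have "\<exists>p. \<forall>i. G p i (p i)"
  proof (rule dependent_wf_choice[OF wf_lt])
    fix f g :: "'k \<Rightarrow> 's" and x r
    assume "\<And>z. (z, x) \<in> {(x, y). x \<sqsubset> y} \<Longrightarrow> f z = g z"
    then show "G f x r = G g x r" by (auto simp: G_def)
  next
    fix x and f :: "'k \<Rightarrow> 's"
    assume "\<And>y. (y, x) \<in> {(x, y). x \<sqsubset> y} \<Longrightarrow> G f y (f y)"
    then have G: "G f y (f y)" if "y \<sqsubset> x" for y using that by simp
    \<comment> \<open>At the least index there is nothing to bound and the construction starts from
      \<open>s0\<close>; \<open>R\<close> need not be reflexive, hence the disjunction.\<close>
    have "\<exists>q\<in>P. (q = s0 \<or> R s0 q) \<and> (\<forall>j. j \<sqsubset> x \<longrightarrow> R (f j) q)"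
    proof (cases "\<exists>j. j \<sqsubset> x")
      case True
      have "\<exists>q\<in>P. \<forall>j. j \<sqsubset> x \<longrightarrow> R (f j) q"
        by (rule closed) (use G True in \<open>auto simp: G_def\<close>)
      then show ?thesis using G True trans unfolding G_def by meson
    qed (use s0 in auto)
    then show "\<exists>r. G f x r" unfolding G_def using dense trans by (metis (no_types))
  qed
  then show ?thesis using that unfolding G_def by blast
qed

lemma chain_limit:
  assumes "\<And>j j' x. j \<in> J \<Longrightarrow> j' \<in> J \<Longrightarrow> x \<sqsubset> \<delta> j \<Longrightarrow> x \<sqsubset> \<delta> j' \<Longrightarrow> \<eta> j x = \<eta> j' x"
  shows "\<exists>\<xi>. \<forall>j\<in>J. agree (\<delta> j) (\<eta> j) \<xi>"
proof -
  \<comment> \<open>The limit is the union of the compatible pieces, with value \<open>False\<close>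
    at coordinates that no piece covers.\<close>
  have "agree (\<delta> j) (\<eta> j) (\<lambda>x. \<exists>j\<in>J. x \<sqsubset> \<delta> j \<and> \<eta> j x)" if "j \<in> J" for j
    using assms[OF that] that unfolding agree_def by blast
  then show ?thesis by blast
qed

text \<open>A condition is a length with a total function extending it. Fewer than \<kappa> lengths
  have a common bound, so chains of conditions continue through limits; the \<open>i\<close>-th
  condition forces its extensions into \<open>D i\<close>, and the first one is
  \<open>(\<delta>, \<eta>)\<close>.\<close>

lemma baire:
  fixes D :: "'k \<Rightarrow> ('k \<Rightarrow> bool) set"
  assumes D: "\<And>i. opn (D i)" "\<And>i. dns (D i)"
  shows "\<exists>\<xi>\<in>\<Inter>i. D i. agree \<delta> \<eta> \<xi>"
proof -
  define R where "R s s' \<longleftrightarrow> fst s \<sqsubseteq> fst s' \<and> agree (fst s) (snd s) (snd s')"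
    for s s' :: "'k \<times> ('k \<Rightarrow> bool)"
  define Q where "Q i s \<longleftrightarrow> i \<sqsubset> fst s \<and> (\<forall>\<xi>. agree (fst s) (snd s) \<xi> \<longrightarrow> \<xi> \<in> D i)"
    for i and s :: "'k \<times> ('k \<Rightarrow> bool)"
  obtain p where p: "\<And>i. Q i (p i)" "\<And>i. R (\<delta>, \<eta>) (p i)" "\<And>i j. j \<sqsubset> i \<Longrightarrow> R (p j) (p i)"
  proof (rule generic_chain[of R UNIV Q "(\<delta>, \<eta>)"])
    show "R a c" if "R a b" "R b c" for a b c
      using that unfolding R_def by (metis agree_mono agree_trans O.order.trans)
    show "\<exists>q\<in>UNIV. \<forall>j. j \<sqsubset> i \<longrightarrow> R (p j) q"
      if p: "\<And>j j'. j \<sqsubset> j' \<Longrightarrow> j' \<sqsubset> i \<Longrightarrow> R (p j) (p j')" for i and p :: "'k \<Rightarrow> _"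
    proof -
      have "\<exists>\<xi>. \<forall>j\<in>underS \<kappa> i. agree (fst (p j)) (snd (p j)) \<xi>"
      proof (rule chain_limit)
        fix j j' x assume "j \<sqsubset> i" "j' \<sqsubset> i" "x \<sqsubset> fst (p j)" "x \<sqsubset> fst (p j')"
        then show "snd (p j) x = snd (p j') x"
          using p[of j j'] p[of j' j] O.less_linear[of j j'] unfolding R_def agree_def by metis
      qed
      moreover obtain d where "\<forall>x\<in>(\<lambda>j. fst (p j)) ` underS \<kappa> i. x \<sqsubset> d"
        using bdd_image[OF bdd_underS(1)] unfolding bdd_def by blast
      ultimately show ?thesis unfolding R_def by (metis O.less_imp_le UNIV_I fst_conv snd_conv imageI)
    qed
    show "\<exists>q'\<in>UNIV. R q q' \<and> Q i q'" for i q
    proof -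
      obtain \<xi> where \<xi>: "\<xi> \<in> D i" "agree (fst q) (snd q) \<xi>" using D(2) unfolding dns_def by blast
      obtain d where d: "\<And>\<zeta>. agree d \<xi> \<zeta> \<Longrightarrow> \<zeta> \<in> D i" using D(1) \<xi>(1) unfolding opn_iff by blast
      obtain d1 where "d \<sqsubset> d1" "i \<sqsubset> d1" using ex_ge2 by blast
      moreover obtain d2 where "d1 \<sqsubset> d2" "fst q \<sqsubset> d2" using ex_ge2 by blast
      ultimately have "R q (d2, \<xi>)" "Q i (d2, \<xi>)"
        unfolding R_def Q_def using \<xi> d by (auto intro: O.less_imp_le O.less_trans agree_mono_lt)
      then show ?thesis by blast
    qed
  qed auto
  have "\<exists>\<xi>. \<forall>j\<in>UNIV. agree (fst (p j)) (snd (p j)) \<xi>"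
  proof (rule chain_limit)
    fix j j' x assume "x \<sqsubset> fst (p j)" "x \<sqsubset> fst (p j')"
    then show "snd (p j) x = snd (p j') x"
      using p(3)[of j j'] p(3)[of j' j] O.less_linear[of j j'] unfolding R_def agree_def by metis
  qed
  then obtain \<xi> where \<xi>: "\<And>j. agree (fst (p j)) (snd (p j)) \<xi>" by blast
  have "\<xi> \<in> D i" for i using p(1) \<xi> unfolding Q_def by blast
  moreover have "agree \<delta> \<eta> \<xi>"
    using p(2) \<xi> unfolding R_def by (metis agree_mono agree_trans fst_conv snd_conv)
  ultimately show ?thesis by blast
qed

lemma comeager_dense: assumes "comeager A" shows "\<exists>\<xi>\<in>A. agree \<delta> \<eta> \<xi>"
proof -
  obtain D :: "'k \<Rightarrow> _" where "\<And>i. opn (D i)" "\<And>i. dns (D i)" "(\<Inter>i. D i) \<subseteq> A"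
    using assms unfolding comeager_def by blast
  then show ?thesis using baire[of D \<delta> \<eta>] by blast
qed

section \<open>Borel sets have the Baire property\<close>

definition baire_property :: "('k \<Rightarrow> bool) set \<Rightarrow> bool" where
  "baire_property A \<longleftrightarrow> (\<exists>U C. opn U \<and> comeager C \<and> A \<inter> C = U \<inter> C)"

lemma baire_property_compl: assumes "baire_property A" shows "baire_property (UNIV - A)"
proof -
  obtain U C where UC: "opn U" "comeager C" "A \<inter> C = U \<inter> C"
    using assms unfolding baire_property_def by blast
  define V where "V = {\<eta>. \<exists>\<delta>. \<forall>\<xi>. agree \<delta> \<eta> \<xi> \<longrightarrow> \<xi> \<notin> U}"
  have "opn V" unfolding opn_iff V_def using agree_trans by fast
  moreover have "comeager (U \<union> V)"
  proof (rule comeager_opn_dns)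
    show "opn (U \<union> V)" using UC(1) \<open>opn V\<close> by (rule openin_Un)
    show "dns (U \<union> V)" unfolding dns_def
    proof (intro allI)
      fix \<eta> \<delta>
      show "\<exists>\<xi>\<in>U \<union> V. agree \<delta> \<eta> \<xi>"
      proof (cases "\<exists>\<xi>\<in>U. agree \<delta> \<eta> \<xi>")
        case False
        then have "\<eta> \<in> V" unfolding V_def by blast
        then show ?thesis using agree_refl by blast
      qed blast
    qed
  qed
  then have "comeager ((U \<union> V) \<inter> C)" using UC(2) by (rule comeager_Int)
  moreover have "U \<inter> V = {}" unfolding V_def using agree_refl by blast
  then have "(UNIV - A) \<inter> ((U \<union> V) \<inter> C) = V \<inter> ((U \<union> V) \<inter> C)" using UC(3) by blast
  ultimately show ?thesis unfolding baire_property_def by blast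
qed

lemma baire_property_Union:
  assumes "\<And>A. A \<in> \<A> \<Longrightarrow> baire_property A" "|\<A>| \<le>o \<kappa>"
  shows "baire_property (\<Union>\<A>)"
proof (cases "\<A> = {}")
  case True
  then show ?thesis unfolding baire_property_def using comeager_UNIV opn_UNIV by (metis Sup_empty openin_empty)
next
  case False
  have "|\<A>| \<le>o |UNIV :: 'k set|" using assms(2) card_UNIV by (meson ordIso_symmetric ordLeq_ordIso_trans)
  from card_of_ordLeq2[OF False, THEN iffD2, OF this]
  obtain g :: "'k \<Rightarrow> _" where g: "range g = \<A>" ..
  then have "\<forall>k. \<exists>U C. opn U \<and> comeager C \<and> g k \<inter> C = U \<inter> C"
    using assms(1) unfolding baire_property_def by blast
  then obtain U C where UC: "\<And>k. opn (U k)" "\<And>k. comeager (C k)" "\<And>k. g k \<inter> C k = U k \<inter> C k"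
    by metis
  have "opn (\<Union>k. U k)" using UC(1) by blast
  moreover have "comeager (\<Inter>k. C k)" by (rule comeager_INT) (rule UC(2))
  moreover have "\<Union>\<A> \<inter> (\<Inter>k. C k) = (\<Union>k. U k) \<inter> (\<Inter>k. C k)" unfolding g[symmetric] using UC(3) by blast
  ultimately show ?thesis unfolding baire_property_def by blast
qed

lemma kappa_borel_baire_property:
  "A \<in> kappa_borel \<kappa> (cantor_topology \<kappa>) \<Longrightarrow> baire_property A"
proof (induction rule: kappa_borel.induct)
  case ("open" U)
  then show ?case unfolding baire_property_def using comeager_UNIV by blast
next
  case (compl A)
  then show ?case using baire_property_compl by simp
next
  case (union \<A>)
  then show ?case using baire_property_Union by blast
next
  case (inter \<A>)
  have "baire_property (\<Union>((-) UNIV ` \<A>))"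
  proof (rule baire_property_Union)
    show "|(-) UNIV ` \<A>| \<le>o \<kappa>" using inter card_of_image ordLeq_transitive by blast
  qed (use inter baire_property_compl in blast)
  moreover have "UNIV - \<Union>((-) UNIV ` \<A>) = \<Inter>\<A>" by blast
  ultimately show ?case using baire_property_compl by metis
qed

text \<open>The preimages of the coordinate conditions are \<kappa> many sets with the Baire
  property. On the intersection of the corresponding comeager sets they are relatively open, so
  every coordinate of \<open>f\<close> is continuous there.\<close>

lemma borel_function_continuous_comeager:
  assumes "borel_function \<kappa> f"
  shows "\<exists>C. comeager C \<and> (\<forall>\<eta>\<in>C. \<forall>x. \<exists>\<delta>. \<forall>\<xi>\<in>C. agree \<delta> \<eta> \<xi> \<longrightarrow> f \<xi> x = f \<eta> x)"
proof -
  have "baire_property (f -` {\<eta>. \<eta> x = v})" for x v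
    using assms opn_coord kappa_borel_baire_property unfolding borel_function_def by blast
  then have "\<forall>x v. \<exists>U C. opn U \<and> comeager C \<and> f -` {\<eta>. \<eta> x = v} \<inter> C = U \<inter> C"
    unfolding baire_property_def by blast
  then obtain U C where UC: "\<And>x v. opn (U x v)" "\<And>x v. comeager (C x v)"
      "\<And>x v. f -` {\<eta>. \<eta> x = v} \<inter> C x v = U x v \<inter> C x v" by metis
  define C' where "C' = (\<Inter>x. C x True \<inter> C x False)"
  have C': "\<eta> \<in> C' \<Longrightarrow> \<eta> \<in> C x v" for \<eta> x v unfolding C'_def by (cases v) auto
  have iff: "f \<xi> x = v \<longleftrightarrow> \<xi> \<in> U x v" if "\<xi> \<in> C'" for \<xi> x v
    using UC(3)[of x v] C'[OF that, of x v] by blast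
  have "comeager C'" unfolding C'_def by (intro comeager_INT comeager_Int UC)
  moreover have "\<exists>\<delta>. \<forall>\<xi>\<in>C'. agree \<delta> \<eta> \<xi> \<longrightarrow> f \<xi> x = f \<eta> x" if "\<eta> \<in> C'" for \<eta> x
    using UC(1)[of x "f \<eta> x"] iff[OF that, of x "f \<eta> x"] iff unfolding opn_iff by blast
  ultimately show ?thesis by blast
qed

section \<open>Translations, that is, addition of a set modulo 2\<close>

definition flip :: "'k set \<Rightarrow> ('k \<Rightarrow> bool) \<Rightarrow> 'k \<Rightarrow> bool" where
  "flip h \<eta> = (\<lambda>x. \<eta> x \<noteq> (x \<in> h))"

lemma flip_flip: "flip g (flip h \<eta>) = flip (sym_diff g h) \<eta>"
  unfolding flip_def by (auto simp: fun_eq_iff)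

lemma flip_self [simp]: "flip h (flip h \<eta>) = \<eta>" and flip_empty [simp]: "flip {} \<eta> = \<eta>"
  unfolding flip_def by (auto simp: fun_eq_iff)

lemma agree_flip: "agree \<delta> (flip h \<eta>) (flip h \<xi>) \<longleftrightarrow> agree \<delta> \<eta> \<xi>"
  unfolding flip_def agree_def by auto

lemma agree_flip_off: "(\<And>x. x \<in> h \<Longrightarrow> \<delta> \<sqsubseteq> x) \<Longrightarrow> agree \<delta> \<eta> (flip h \<eta>)"
  unfolding flip_def agree_def using O.leD by blast

lemma opn_vimage_flip: "opn U \<Longrightarrow> opn (flip h -` U)"
  unfolding opn_iff by (metis agree_flip vimage_eq)

lemma dns_vimage_flip: "dns U \<Longrightarrow> dns (flip h -` U)"
  unfolding dns_def by (metis agree_flip flip_self vimage_eq)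

lemma comeager_vimage_flip:
  assumes "comeager A" shows "comeager (flip h -` A)"
proof -
  obtain D :: "'k \<Rightarrow> _" where "\<And>i. opn (D i)" "\<And>i. dns (D i)" "(\<Inter>i. D i) \<subseteq> A"
    using assms unfolding comeager_def by blast
  then show ?thesis unfolding comeager_def
    by (intro exI[of _ "\<lambda>i. flip h -` D i"]) (auto simp: opn_vimage_flip dns_vimage_flip)
qed

text \<open>There are only \<kappa> many bounded sets, so the translates of all \<open>D i\<close>
  by bounded sets can be intersected. The result is invariant because bounded sets are closed under
  symmetric difference.\<close>

lemma comeager_flip_invariant:
  assumes "comeager A"
  shows "\<exists>D :: 'k \<Rightarrow> _. (\<forall>i. opn (D i) \<and> dns (D i)) \<and> (\<Inter>i. D i) \<subseteq> A \<and>
    (\<forall>h \<eta>. bdd h \<longrightarrow> \<eta> \<in> (\<Inter>i. D i) \<longrightarrow> flip h \<eta> \<in> (\<Inter>i. D i))"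
proof -
  obtain s :: "'k \<Rightarrow> 'k set" where s: "\<And>h. bdd h \<Longrightarrow> h \<in> range s" using ex_enum_bdd by blast
  obtain D :: "'k \<Rightarrow> _" where D: "\<And>i. opn (D i)" "\<And>i. dns (D i)" "(\<Inter>i. D i) \<subseteq> A"
    using assms unfolding comeager_def by blast
  obtain g :: "'k \<times> 'k \<Rightarrow> 'k" where g: "inj g"
    using card_prod_le[OF card_self card_self] card_le_iff_inj by blast
  \<comment> \<open>The index \<open>z\<close> codes a pair \<open>(i, j)\<close>, and an index
    outside the range of \<open>g\<close> merely repeats some pair. Unbounded members of the
    enumeration \<open>s\<close> are neutralised by \<open>UNIV\<close>.\<close>
  define D' where "D' z = (let (i, j) = inv g z in
      if bdd (s j) then flip (s j) -` D i else UNIV)" for z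
  have D': "\<eta> \<in> (\<Inter>z. D' z) \<longleftrightarrow> (\<forall>h i. bdd h \<longrightarrow> flip h \<eta> \<in> D i)" for \<eta>
  proof
    assume \<eta>: "\<eta> \<in> (\<Inter>z. D' z)"
    show "\<forall>h i. bdd h \<longrightarrow> flip h \<eta> \<in> D i"
    proof (intro allI impI)
      fix h i assume "bdd h"
      moreover obtain j where "h = s j" using s[OF \<open>bdd h\<close>] by blast
      ultimately show "flip h \<eta> \<in> D i" using INT_D[OF \<eta>, of "g (i, j)"] g by (simp add: D'_def)
    qed
  qed (auto simp: D'_def Let_def split: prod.split)
  show ?thesis
  proof (intro exI conjI allI impI)
    show "opn (D' z)" "dns (D' z)" for z
      using D by (auto simp: D'_def Let_def opn_vimage_flip dns_vimage_flip dns_UNIV split: prod.split)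
    have "bdd {}" unfolding bdd_def by simp
    then show "(\<Inter>z. D' z) \<subseteq> A" using D' D(3) flip_empty by (metis (no_types) INT_I subset_iff)
    show "flip h \<eta> \<in> (\<Inter>z. D' z)" if "bdd h" "\<eta> \<in> (\<Inter>z. D' z)" for h \<eta>
    proof -
      have "bdd (sym_diff h' h)" if "bdd h'" for h'
        by (rule bdd_subset[OF bdd_Un[OF \<open>bdd h'\<close> \<open>bdd h\<close>]]) blast
      then show ?thesis using that(2) unfolding D' flip_flip by blast
    qed
  qed
qed

subsection \<open>Stationary sets and coordinates\<close>

text \<open>The sequence need not be increasing. Its existence already makes \<open>a\<close> a
  nonzero limit of cofinality \<omega>.\<close>

definition ladder :: "(nat \<Rightarrow> 'k) \<Rightarrow> 'k \<Rightarrow> bool" where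
  "ladder l a \<longleftrightarrow> (\<forall>n. l n \<sqsubset> a) \<and> (\<forall>b. b \<sqsubset> a \<longrightarrow> (\<exists>n. b \<sqsubset> l n))"

definition closed_under :: "('k \<Rightarrow> 'k) \<Rightarrow> 'k \<Rightarrow> bool" where
  "closed_under g a \<longleftrightarrow> (\<forall>x. x \<sqsubset> a \<longrightarrow> g x \<sqsubset> a)"

text \<open>Stationarity of the set of \<open>\<omega>\<close>-cofinal points of \<open>A\<close>, with clubs given by closure functions.\<close>

definition omega_stationary :: "'k set \<Rightarrow> bool" where
  "omega_stationary A \<longleftrightarrow> (\<forall>g. \<exists>a\<in>A. (\<exists>l. ladder l a) \<and> closed_under g a)"

lemma ex_bound_fun:
  assumes "\<And>x. bdd (F x)"
  obtains G where "\<And>x z. z \<in> F x \<Longrightarrow> z \<sqsubset> G x"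
proof -
  have "\<forall>x. \<exists>b. \<forall>z\<in>F x. z \<sqsubset> b" using assms unfolding bdd_def by blast
  from choice[OF this] show ?thesis using that by blast
qed

lemma bdd_atMost: "bdd {y. y \<sqsubseteq> x}"
  using ex_gt[of x] O.le_less_trans unfolding bdd_def by blast

text \<open>Iterate a function \<open>G\<close> for which \<open>G x\<close> exceeds
  \<open>x\<close> and all values of \<open>g\<close> up to \<open>x\<close>. The supremum of the
  iterates is closed under \<open>g\<close>, and the iterates are a ladder for it.\<close>

lemma ex_ladder_closed: "\<exists>a l. ladder l a \<and> closed_under g a \<and> a0 \<sqsubset> a"
proof -
  have "bdd (insert x (g ` {y. y \<sqsubseteq> x}))" for x
    using bdd_Un[OF bdd_atMost bdd_image[OF bdd_atMost]] by (rule bdd_subset) auto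
  then obtain G where G: "\<And>x z. z \<in> insert x (g ` {y. y \<sqsubseteq> x}) \<Longrightarrow> z \<sqsubset> G x"
    by (rule ex_bound_fun[of "\<lambda>x. insert x (g ` {y. y \<sqsubseteq> x})"]) blast
  define l where "l n = (G ^^ n) a0" for n
  have Suc: "l n \<sqsubset> l (Suc n)" and cl: "y \<sqsubseteq> l n \<Longrightarrow> g y \<sqsubset> l (Suc n)" for n y
    using G unfolding l_def by auto
  have ex: "\<exists>a. \<forall>n. l n \<sqsubset> a" using bdd_range_nat[of l] unfolding bdd_def by blast
  define a where "a = O.Least (\<lambda>a. \<forall>n. l n \<sqsubset> a)"
  have a: "l n \<sqsubset> a" for n using O.LeastI_ex[OF ex] unfolding a_def by blast
  have below: "\<exists>n. b \<sqsubset> l n" if b: "b \<sqsubset> a" for b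
  proof -
    obtain n where "\<not> l n \<sqsubset> b" using O.not_less_Least b unfolding a_def by blast
    then have "b \<sqsubset> l (Suc n)" using Suc O.not_less O.le_less_trans by blast
    then show ?thesis ..
  qed
  have "closed_under g a" unfolding closed_under_def
    using below cl a O.less_imp_le O.less_trans by meson
  moreover have "a0 \<sqsubset> a" using a[of 0] by (simp add: l_def)
  ultimately show ?thesis using a below unfolding ladder_def by blast
qed

text \<open>Solovay's splitting theorem for \<open>\<omega>\<close>-cofinal points: for some \<open>n\<close> the map sending a point to the
  \<open>n\<close>-th element of its ladder has unboundedly many values that are attained stationarily often.\<close>

lemma ex_disjoint_omega_stationary:
  "\<exists>S :: 'k \<Rightarrow> 'k set. (\<forall>i. omega_stationary (S i)) \<and> (\<forall>i j a. a \<in> S i \<longrightarrow> a \<in> S j \<longrightarrow> i = j)"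
proof -
  define L where "L a = (SOME l. ladder l a)" for a
  have L: "ladder (L a) a" if "ladder l a" for l a unfolding L_def using someI[of "\<lambda>l. ladder l a", OF that] .
  \<comment> \<open>Otherwise every \<open>n\<close> has a bound \<open>\<beta> n\<close> for the
    \<open>n\<close>-th ladder elements at closure points of \<open>g n\<close>. A point beyond all
    \<open>\<beta> n\<close> that is closed under all \<open>g n\<close> would then have a bounded
    ladder.\<close>
  have "\<exists>n. \<forall>\<beta>. omega_stationary {a. \<beta> \<sqsubseteq> L a n}"
  proof (rule ccontr)
    assume "\<nexists>n. \<forall>\<beta>. omega_stationary {a. \<beta> \<sqsubseteq> L a n}"
    then have "\<forall>n. \<exists>\<beta> g. \<forall>a l. ladder l a \<longrightarrow> \<beta> \<sqsubseteq> L a n \<longrightarrow> \<not> closed_under g a"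
      unfolding omega_stationary_def by blast
    then obtain \<beta> g where g: "\<And>n a l. ladder l a \<Longrightarrow> \<beta> n \<sqsubseteq> L a n \<Longrightarrow> \<not> closed_under (g n) a"
      by metis
    obtain G where "\<And>x z. z \<in> range (\<lambda>n. g n x) \<Longrightarrow> z \<sqsubset> G x"
      using bdd_range_nat by (rule ex_bound_fun[of "\<lambda>x. range (\<lambda>n. g n x)"]) blast
    then have G: "g n x \<sqsubset> G x" for n x by blast
    obtain b where b: "\<And>n. \<beta> n \<sqsubset> b" using bdd_range_nat[of \<beta>] unfolding bdd_def by blast
    obtain a l where a: "ladder l a" "closed_under G a" "b \<sqsubset> a" using ex_ladder_closed by blast
    have "closed_under (g n) a" for n
      using a(2) G unfolding closed_under_def using O.less_trans by blast
    then have "L a n \<sqsubset> b" for n using g[OF a(1)] b O.not_less O.less_trans by meson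
    then show False using L[OF a(1)] a(3) O.less_asym unfolding ladder_def by blast
  qed
  then obtain n where n: "\<And>\<beta>. omega_stationary {a. \<beta> \<sqsubseteq> L a n}" by blast
  define V where "V = {v. omega_stationary {a. L a n = v}}"
  have "\<exists>v\<in>V. \<beta> \<sqsubseteq> v" for \<beta>
  proof (rule ccontr)
    assume "\<not> (\<exists>v\<in>V. \<beta> \<sqsubseteq> v)"
    then have "\<forall>v. \<exists>g. \<beta> \<sqsubseteq> v \<longrightarrow> (\<forall>a l. ladder l a \<longrightarrow> L a n = v \<longrightarrow> \<not> closed_under g a)"
      unfolding V_def omega_stationary_def by blast
    then obtain g where g: "\<And>v a l. \<beta> \<sqsubseteq> v \<Longrightarrow> ladder l a \<Longrightarrow> L a n = v \<Longrightarrow> \<not> closed_under (g v) a"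
      by metis
    \<comment> \<open>Fodor's argument: a bound \<open>G\<close> for all \<open>g v\<close> with
      \<open>v\<close> up to \<open>x\<close> plays the role of a diagonal intersection, since a
      closure point of \<open>G\<close> is closed under \<open>g v\<close> for every smaller
      \<open>v\<close>.\<close>
    have "bdd (\<Union>v\<in>{y. y \<sqsubseteq> x}. g v ` {y. y \<sqsubseteq> x})" for x
      by (intro bdd_UN bdd_image bdd_atMost)
    then obtain G where G: "\<And>x z. z \<in> (\<Union>v\<in>{y. y \<sqsubseteq> x}. g v ` {y. y \<sqsubseteq> x}) \<Longrightarrow> z \<sqsubset> G x"
      by (rule ex_bound_fun[of "\<lambda>x. \<Union>v\<in>{y. y \<sqsubseteq> x}. g v ` {y. y \<sqsubseteq> x}"]) blast
    obtain a l where a: "\<beta> \<sqsubseteq> L a n" "ladder l a" "closed_under G a"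
      using n[of \<beta>] unfolding omega_stationary_def by blast
    have v: "L a n \<sqsubset> a" using L[OF a(2)] unfolding ladder_def by blast
    have "closed_under (g (L a n)) a" unfolding closed_under_def
    proof (intro allI impI)
      fix y assume y: "y \<sqsubset> a"
      define x where "x = (if y \<sqsubseteq> L a n then L a n else y)"
      have x: "x \<sqsubset> a" "y \<sqsubseteq> x" "L a n \<sqsubseteq> x" using v y O.linear by (auto simp: x_def)
      then have "g (L a n) y \<sqsubset> G x" using G by blast
      then show "g (L a n) y \<sqsubset> a" using a(3) x(1) O.less_trans unfolding closed_under_def by blast
    qed
    then show False using g a(1,2) by blast
  qed
  then have "\<not> bdd V" unfolding bdd_def using O.leD by blast
  then have "\<kappa> \<le>o |V|" unfolding bdd_iff_small
    using Card_order card_order_on_well_order_on not_ordLess_iff_ordLeq card_of_Well_order by blast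
  then have "|UNIV :: 'k set| \<le>o |V|" using card_UNIV ordIso_ordLeq_trans by blast
  then obtain w :: "'k \<Rightarrow> 'k" where w: "inj w" "range w \<subseteq> V" unfolding card_of_ordLeq[symmetric] by blast
  show ?thesis
  proof (intro exI conjI allI impI)
    show "omega_stationary {a. L a n = w i}" for i using w(2) unfolding V_def by blast
    show "i = j" if "a \<in> {a. L a n = w i}" "a \<in> {a. L a n = w j}" for i j a
      using that w(1) by (simp add: inj_eq)
  qed
qed

text \<open>A spare component of the encoded tuple is chosen so as to push the code above both
  \<open>r\<close> and \<open>\<gamma>\<close>. Hence changes in late rows or late columns do not
  affect a given initial segment of a point.\<close>

lemma ex_coordinates:
  "\<exists>e :: bool \<Rightarrow> 'k \<Rightarrow> 'k \<Rightarrow> 'k. (\<forall>b r \<gamma> b' r' \<gamma>'. e b r \<gamma> = e b' r' \<gamma>' \<longrightarrow> b = b' \<and> r = r' \<and> \<gamma> = \<gamma>') \<and>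
     (\<forall>b r \<gamma>. r \<sqsubseteq> e b r \<gamma> \<and> \<gamma> \<sqsubseteq> e b r \<gamma>)"
proof -
  obtain J :: "'k \<times> bool \<times> 'k \<times> 'k \<Rightarrow> 'k" where J: "inj J"
    using card_prod_le[OF card_self card_prod_le[OF card_bool card_prod_le[OF card_self card_self]]]
    unfolding card_le_iff_inj by blast
  have ex: "\<exists>z. r \<sqsubseteq> J (z, b, r, \<gamma>) \<and> \<gamma> \<sqsubseteq> J (z, b, r, \<gamma>)" for b r \<gamma>
  proof -
    obtain m where "r \<sqsubset> m" "\<gamma> \<sqsubset> m" using ex_ge2 by blast
    moreover have "inj (\<lambda>z. J (z, b, r, \<gamma>))" by (rule injI) (use J in \<open>simp add: inj_eq\<close>)
    from inj_unbounded[OF this, of m] obtain z where "m \<sqsubset> J (z, b, r, \<gamma>)" by blast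
    ultimately show ?thesis using O.less_trans O.less_imp_le by blast
  qed
  define z where "z b r \<gamma> = (SOME z. r \<sqsubseteq> J (z, b, r, \<gamma>) \<and> \<gamma> \<sqsubseteq> J (z, b, r, \<gamma>))" for b r \<gamma>
  have "r \<sqsubseteq> J (z b r \<gamma>, b, r, \<gamma>) \<and> \<gamma> \<sqsubseteq> J (z b r \<gamma>, b, r, \<gamma>)" for b r \<gamma>
    unfolding z_def using someI_ex[OF ex] .
  then show ?thesis
    by (intro exI[of _ "\<lambda>b r \<gamma>. J (z b r \<gamma>, b, r, \<gamma>)"]) (use J in \<open>auto simp: inj_eq\<close>)
qed

text \<open>Makes room in a single row for an old row together with the codes of local classes,
  which are indexed by triples.\<close>

lemma ex_sum_coordinates: "\<exists>\<psi> :: 'k + 'k \<times> 'k \<times> 'k \<Rightarrow> 'k. inj \<psi>"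
proof -
  obtain J :: "bool \<times> 'k \<times> 'k \<times> 'k \<Rightarrow> 'k" where J: "inj J"
    using card_prod_le[OF card_bool card_prod_le[OF card_self card_prod_le[OF card_self card_self]]]
    unfolding card_le_iff_inj by blast
  define \<psi> where "\<psi> = (\<lambda>x :: 'k + 'k \<times> 'k \<times> 'k. case x of Inl y \<Rightarrow> J (True, y, y, y) | Inr x \<Rightarrow> J (False, x))"
  have "inj \<psi>" unfolding inj_def \<psi>_def using J by (auto simp: inj_eq split: sum.splits)
  then show ?thesis by blast
qed

lemma bdd_UN_nat: assumes "\<And>n :: nat. bdd (F n)" shows "bdd (\<Union>n. F n)"
proof -
  have "\<forall>n. \<exists>b. \<forall>x\<in>F n. x \<sqsubset> b" using assms unfolding bdd_def by blast
  from choice[OF this] obtain g where g: "\<And>n x. x \<in> F n \<Longrightarrow> x \<sqsubset> g n" by blast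
  obtain b where "\<And>n. g n \<sqsubset> b" using bdd_range_nat[of g] unfolding bdd_def by blast
  then have "\<forall>x\<in>(\<Union>n. F n). x \<sqsubset> b" using g O.less_trans by blast
  then show ?thesis unfolding bdd_def ..
qed

text \<open>States are coded by elements of \<kappa>. A point \<open>a\<close> of \<open>A\<close>
  that is closed under the passage from codes to the codes and lengths of successors captures a
  whole \<omega>-chain below it, and a ladder for \<open>a\<close> tells how long the successive
  states have to be.\<close>

lemma omega_stationary_chain:
  fixes en :: "'k \<Rightarrow> 's" and d :: "'s \<Rightarrow> 'k" and N :: "nat \<Rightarrow> 's \<Rightarrow> 's \<Rightarrow> bool"
  assumes A: "omega_stationary A" and en: "Q \<subseteq> range en" and q0: "q0 \<in> Q"
    and step: "\<And>n q \<zeta>. q \<in> Q \<Longrightarrow> \<exists>q'\<in>Q. N n q q' \<and> \<zeta> \<sqsubset> d q'"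
  obtains a q where "a \<in> A" "q 0 = q0" "\<And>n. q n \<in> Q" "\<And>n. N n (q n) (q (Suc n))"
    "\<And>n. d (q n) \<sqsubset> a" "\<And>b. b \<sqsubset> a \<Longrightarrow> \<exists>n. b \<sqsubset> d (q n)"
proof -
  define nx where "nx n q \<zeta> = (SOME q'. q' \<in> Q \<and> N n q q' \<and> \<zeta> \<sqsubset> d q')" for n q \<zeta>
  have nx: "nx n q \<zeta> \<in> Q \<and> N n q (nx n q \<zeta>) \<and> \<zeta> \<sqsubset> d (nx n q \<zeta>)" if "q \<in> Q" for n q \<zeta>
  proof -
    have "\<exists>q'. q' \<in> Q \<and> N n q q' \<and> \<zeta> \<sqsubset> d q'" using step[OF that, of n \<zeta>] by blast
    then show ?thesis unfolding nx_def by (rule someI_ex)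
  qed
  define cd where "cd q = (SOME \<xi>. en \<xi> = q)" for q
  have cd: "en (cd q) = q" if "q \<in> Q" for q
  proof -
    have "\<exists>\<xi>. en \<xi> = q" using en that by blast
    then show ?thesis unfolding cd_def by (rule someI_ex)
  qed
  \<comment> \<open>\<open>F x\<close> collects the codes and lengths obtained in one step, for any
    \<open>n\<close>, from a state with code at most \<open>x\<close> and a demanded length at most
    \<open>x\<close>, along with those of the initial state.\<close>
  define F where "F x = insert (cd q0) (insert (d q0)
    (\<Union>n. \<Union>\<xi>\<in>{y. y \<sqsubseteq> x}. \<Union>\<zeta>\<in>{y. y \<sqsubseteq> x}. {cd (nx n (en \<xi>) \<zeta>), d (nx n (en \<xi>) \<zeta>)}))" for x
  have two: "bdd {x, y}" for x y using ex_ge2 unfolding bdd_def by blast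
  have "bdd (F x)" for x
  proof -
    have "bdd (\<Union>n. \<Union>\<xi>\<in>{y. y \<sqsubseteq> x}. \<Union>\<zeta>\<in>{y. y \<sqsubseteq> x}. {cd (nx n (en \<xi>) \<zeta>), d (nx n (en \<xi>) \<zeta>)})"
      by (intro bdd_UN_nat bdd_UN bdd_atMost two)
    from bdd_Un[OF two[of "cd q0" "d q0"] this] show ?thesis unfolding F_def by simp
  qed
  then obtain G where G: "\<And>x z. z \<in> F x \<Longrightarrow> z \<sqsubset> G x" by (rule ex_bound_fun[of F]) blast
  obtain a l where a: "a \<in> A" "ladder l a" "closed_under G a"
    using A unfolding omega_stationary_def by blast
  have below: "z \<sqsubset> a" if "z \<in> F x" "x \<sqsubset> a" for z x
    using G[OF that(1)] a(3) that(2) O.less_trans unfolding closed_under_def by blast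
  have l: "l n \<sqsubset> a" for n using a(2) unfolding ladder_def by blast
  \<comment> \<open>Step \<open>n\<close> is asked to pass the \<open>n\<close>-th ladder element,
    which makes the lengths cofinal in \<open>a\<close>.\<close>
  define q where "q = rec_nat q0 (\<lambda>n s. nx n s (l n))"
  have q_0: "q 0 = q0" and q_Suc: "q (Suc n) = nx n (q n) (l n)" for n unfolding q_def by simp_all
  have qQ: "q n \<in> Q" for n by (induction n) (use q0 nx in \<open>auto simp: q_0 q_Suc\<close>)
  have "cd (q n) \<sqsubset> a \<and> d (q n) \<sqsubset> a" for n
  proof (induction n)
    case 0
    have "cd q0 \<in> F (l 0)" "d q0 \<in> F (l 0)" unfolding F_def by auto
    then show ?case using below l unfolding q_0 by blast
  next
    case (Suc n)
    define x where "x = (if cd (q n) \<sqsubseteq> l n then l n else cd (q n))"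
    have x: "x \<sqsubset> a" "cd (q n) \<sqsubseteq> x" "l n \<sqsubseteq> x" using Suc l O.linear by (auto simp: x_def)
    have "{cd (nx n (en (cd (q n))) (l n)), d (nx n (en (cd (q n))) (l n))} \<subseteq> F x"
      unfolding F_def using x(2,3) by blast
    then have "cd (q (Suc n)) \<in> F x" "d (q (Suc n)) \<in> F x" unfolding q_Suc cd[OF qQ] by auto
    then show ?case using below[OF _ x(1)] by blast
  qed
  moreover have "\<exists>n. b \<sqsubset> d (q n)" if b: "b \<sqsubset> a" for b
  proof -
    obtain n where n: "b \<sqsubset> l n" using a(2) b unfolding ladder_def by blast
    have "l n \<sqsubset> d (q (Suc n))" using nx[OF qQ] unfolding q_Suc by blast
    then show ?thesis using n O.less_trans by blast
  qed
  moreover have "N n (q n) (q (Suc n))" for n using nx[OF qQ] unfolding q_Suc by blast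
  ultimately show ?thesis using that[of a q] a(1) q_0 qQ by blast
qed

lemma ex_enum_states:
  "\<exists>en :: 'k \<Rightarrow> 'k \<times> 'k set \<times> 'k set. \<forall>\<delta> A h. bdd A \<longrightarrow> bdd h \<longrightarrow> (\<delta>, A, h) \<in> range en"
proof -
  obtain s :: "'k \<Rightarrow> 'k set" where s: "\<And>h. bdd h \<Longrightarrow> h \<in> range s" using ex_enum_bdd by blast
  obtain J :: "'k \<times> 'k \<times> 'k \<Rightarrow> 'k" where J: "inj J"
    using card_prod_le[OF card_self card_prod_le[OF card_self card_self]] unfolding card_le_iff_inj by blast
  define en where "en \<xi> = (case inv J \<xi> of (a, b, c) \<Rightarrow> (a, s b, s c))" for \<xi>
  have "(\<delta>, A, h) \<in> range en" if Ah: "bdd A" "bdd h" for \<delta> A h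
  proof -
    obtain b c where bc: "A = s b" "h = s c" using s Ah by blast
    have "en (J (\<delta>, b, c)) = (\<delta>, A, h)" unfolding en_def bc using J by simp
    then show ?thesis by (metis rangeI)
  qed
  then show ?thesis by blast
qed

end

text \<open>
  The coordinates of a point of \<open>2\<^sup>\<kappa>\<close> are divided into two \<open>\<kappa> \<times> \<kappa>\<close> matrices, whose entries sit at
  \<open>e False r \<gamma>\<close> and \<open>e True m x\<close>.
\<close>

locale coded = kappa \<kappa> for \<kappa> :: "'k rel" +
  fixes e :: "bool \<Rightarrow> 'k \<Rightarrow> 'k \<Rightarrow> 'k" and S :: "'k \<Rightarrow> 'k set" and \<psi> :: "'k + 'k \<times> 'k \<times> 'k \<Rightarrow> 'k"
  assumes e_inj: "e b r \<gamma> = e b' r' \<gamma>' \<Longrightarrow> b = b' \<and> r = r' \<and> \<gamma> = \<gamma>'"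
    and e_ge_row: "r \<sqsubseteq> e b r \<gamma>" and e_ge_col: "\<gamma> \<sqsubseteq> e b r \<gamma>"
    and S_stat: "omega_stationary (S i)" and S_disj: "a \<in> S i \<Longrightarrow> a \<in> S j \<Longrightarrow> i = j"
    and \<psi>_inj: "inj \<psi>"
begin

lemma e_eq_iff [simp]: "e b r \<gamma> = e b' r' \<gamma>' \<longleftrightarrow> b = b' \<and> r = r' \<and> \<gamma> = \<gamma>'"
  using e_inj by blast

section \<open>The equivalence relations\<close>

definition tpart :: "('k \<Rightarrow> bool) \<Rightarrow> 'k \<Rightarrow> 'k \<Rightarrow> bool" where "tpart \<eta> r \<gamma> = \<eta> (e False r \<gamma>)"
definition upart :: "('k \<Rightarrow> bool) \<Rightarrow> 'k \<Rightarrow> 'k \<Rightarrow> bool" where "upart \<eta> m x = \<eta> (e True m x)"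

text \<open>
  Instead of equality below \<open>a\<close> up to a bounded set, constancy of the difference is required: it allows an
  unbounded set of changes all of whose initial segments are allowed. The premise excludes \<open>a = 0\<close>.
\<close>

definition econst :: "'k \<Rightarrow> ('k \<Rightarrow> bool) \<Rightarrow> ('k \<Rightarrow> bool) \<Rightarrow> bool" where
  "econst a p q \<longleftrightarrow> (\<exists>b. b \<sqsubset> a) \<longrightarrow> (\<exists>b v. b \<sqsubset> a \<and> (\<forall>\<gamma>. b \<sqsubseteq> \<gamma> \<and> \<gamma> \<sqsubset> a \<longrightarrow> (p \<gamma> \<noteq> q \<gamma>) = v))"

text \<open>Clauses with index below \<open>k\<close> are ignored, so the union over
  \<open>k\<close> depends on \<open>X\<close> only modulo bounded sets.\<close>

definition locrel :: "'k set \<Rightarrow> 'k \<Rightarrow> ('k \<Rightarrow> bool) rel" where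
  "locrel X k = {(\<eta>, \<xi>). \<forall>m. k \<sqsubseteq> m \<longrightarrow> upart \<eta> m = upart \<xi> m \<and>
     (m \<notin> X \<longrightarrow> (\<forall>r. \<forall>a\<in>S m. econst a (tpart \<eta> r) (tpart \<xi> r)))}"

definition rowrel :: "('k \<Rightarrow> bool) rel" where
  "rowrel = {(\<eta>, \<xi>). \<forall>r. \<exists>b. \<forall>\<gamma>. b \<sqsubseteq> \<gamma> \<longrightarrow> tpart \<eta> r \<gamma> = tpart \<xi> r \<gamma>}"

definition erel :: "'k set \<Rightarrow> ('k \<Rightarrow> bool) rel" where
  "erel X = (\<Union>k. locrel X k) \<inter> rowrel"

lemma econst_refl: "econst a p p"
  unfolding econst_def by auto

lemma econst_sym: "econst a p q \<Longrightarrow> econst a q p"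
  unfolding econst_def by metis

lemma econst_trans: assumes "econst a p q" "econst a q s" shows "econst a p s"
  unfolding econst_def
proof
  assume ne: "\<exists>b. b \<sqsubset> a"
  obtain b v where 1: "b \<sqsubset> a" "\<And>\<gamma>. b \<sqsubseteq> \<gamma> \<Longrightarrow> \<gamma> \<sqsubset> a \<Longrightarrow> (p \<gamma> \<noteq> q \<gamma>) = v"
    using assms(1) ne unfolding econst_def by blast
  obtain b' v' where 2: "b' \<sqsubset> a" "\<And>\<gamma>. b' \<sqsubseteq> \<gamma> \<Longrightarrow> \<gamma> \<sqsubset> a \<Longrightarrow> (q \<gamma> \<noteq> s \<gamma>) = v'"
    using assms(2) ne unfolding econst_def by blast
  define c where "c = (if b \<sqsubseteq> b' then b' else b)"
  have c: "c \<sqsubset> a" "b \<sqsubseteq> c" "b' \<sqsubseteq> c" using 1(1) 2(1) O.linear by (auto simp: c_def)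
  have "(p \<gamma> \<noteq> s \<gamma>) = (v \<noteq> v')" if "c \<sqsubseteq> \<gamma> \<and> \<gamma> \<sqsubset> a" for \<gamma>
    using 1(2)[of \<gamma>] 2(2)[of \<gamma>] that c O.order.trans by blast
  then show "\<exists>b v. b \<sqsubset> a \<and> (\<forall>\<gamma>. b \<sqsubseteq> \<gamma> \<and> \<gamma> \<sqsubset> a \<longrightarrow> (p \<gamma> \<noteq> s \<gamma>) = v)"
    using c(1) by blast
qed

lemma econst_cong:
  assumes "\<And>\<gamma>. \<gamma> \<sqsubset> a \<Longrightarrow> p \<gamma> = p' \<gamma>" "\<And>\<gamma>. \<gamma> \<sqsubset> a \<Longrightarrow> q \<gamma> = q' \<gamma>"
  shows "econst a p q \<longleftrightarrow> econst a p' q'"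
  unfolding econst_def using assms by (metis (full_types))

lemma econst_diff_cong:
  assumes "\<And>\<gamma>. \<gamma> \<sqsubset> a \<Longrightarrow> (p \<gamma> \<noteq> q \<gamma>) = (p' \<gamma> \<noteq> q' \<gamma>)"
  shows "econst a p q \<longleftrightarrow> econst a p' q'"
  unfolding econst_def using assms by (metis (no_types, lifting))

lemma locrel_refl: "(\<eta>, \<eta>) \<in> locrel X k"
  unfolding locrel_def by (auto simp: econst_refl)

lemma locrel_sym: "(\<eta>, \<xi>) \<in> locrel X k \<Longrightarrow> (\<xi>, \<eta>) \<in> locrel X k"
  unfolding locrel_def using econst_sym by auto

lemma locrel_trans: "(\<eta>, \<xi>) \<in> locrel X k \<Longrightarrow> (\<xi>, \<zeta>) \<in> locrel X k \<Longrightarrow> (\<eta>, \<zeta>) \<in> locrel X k"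
  unfolding locrel_def using econst_trans by (simp; blast)

lemma locrel_mono: "(\<eta>, \<xi>) \<in> locrel X k \<Longrightarrow> k \<sqsubseteq> k' \<Longrightarrow> (\<eta>, \<xi>) \<in> locrel X k'"
  unfolding locrel_def using O.order.trans by blast

lemma equiv_erel: "equiv UNIV (erel X)"
proof (rule equivI)
  show "erel X \<subseteq> UNIV \<times> UNIV" by simp
  show "refl (erel X)" unfolding refl_on_def erel_def rowrel_def using locrel_refl by auto
  show "sym (erel X)" unfolding sym_def erel_def rowrel_def using locrel_sym by fastforce
  show "trans (erel X)"
  proof (rule transI)
    fix \<eta> \<xi> \<zeta> assume 1: "(\<eta>, \<xi>) \<in> erel X" and 2: "(\<xi>, \<zeta>) \<in> erel X"
    obtain k where k: "(\<eta>, \<xi>) \<in> locrel X k" using 1 unfolding erel_def by blast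
    obtain k' where k': "(\<xi>, \<zeta>) \<in> locrel X k'" using 2 unfolding erel_def by blast
    obtain l where l: "k \<sqsubset> l" "k' \<sqsubset> l" using ex_ge2 by blast
    have "(\<eta>, \<zeta>) \<in> locrel X l"
      using locrel_trans locrel_mono[OF k] locrel_mono[OF k'] l O.less_imp_le by blast
    moreover have "(\<eta>, \<zeta>) \<in> rowrel" unfolding rowrel_def
    proof (simp, intro allI)
      fix r
      obtain b where b: "\<And>\<gamma>. b \<sqsubseteq> \<gamma> \<Longrightarrow> tpart \<eta> r \<gamma> = tpart \<xi> r \<gamma>" using 1 unfolding erel_def rowrel_def by blast
      obtain b' where b': "\<And>\<gamma>. b' \<sqsubseteq> \<gamma> \<Longrightarrow> tpart \<xi> r \<gamma> = tpart \<zeta> r \<gamma>" using 2 unfolding erel_def rowrel_def by blast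
      obtain c where "b \<sqsubset> c" "b' \<sqsubset> c" using ex_ge2 by blast
      then show "\<exists>b. \<forall>\<gamma>. b \<sqsubseteq> \<gamma> \<longrightarrow> tpart \<eta> r \<gamma> = tpart \<zeta> r \<gamma>"
        using b b' O.less_imp_le O.order.trans by metis
    qed
    ultimately show "(\<eta>, \<zeta>) \<in> erel X" unfolding erel_def by blast
  qed
qed

subsection \<open>Borelness and reductions\<close>

abbreviation kb :: "(('k \<Rightarrow> bool) \<times> ('k \<Rightarrow> bool)) set \<Rightarrow> bool" where
  "kb A \<equiv> A \<in> kappa_borel \<kappa> (prod_topology (cantor_topology \<kappa>) (cantor_topology \<kappa>))"

lemma kb_const: "kb {p. c}"
  by (rule kappa_borel.open, cases c)
    (use openin_topspace[of "prod_topology (cantor_topology \<kappa>) (cantor_topology \<kappa>)"] in simp_all)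

lemma kb_not: "kb {p. P p} \<Longrightarrow> kb {p. \<not> P p}"
  using kappa_borel.compl[of "{p. P p}" \<kappa> "prod_topology (cantor_topology \<kappa>) (cantor_topology \<kappa>)"]
  by (simp add: Collect_neg_eq Compl_eq_Diff_UNIV)

lemma kb_ex: assumes "\<And>k :: 'k. kb {p. P k p}" shows "kb {p. \<exists>k. P k p}"
proof -
  have "|range (\<lambda>k. {p. P k p})| \<le>o \<kappa>" using card_of_image card_self ordLeq_transitive by blast
  then have "kb (\<Union>(range (\<lambda>k. {p. P k p})))" using assms by (intro kappa_borel.union) auto
  moreover have "\<Union>(range (\<lambda>k. {p. P k p})) = {p. \<exists>k. P k p}" by blast
  ultimately show ?thesis by simp
qed

lemma kb_all: assumes "\<And>k :: 'k. kb {p. P k p}" shows "kb {p. \<forall>k. P k p}"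
  using kb_not[OF kb_ex[OF kb_not[OF assms]]] by simp

lemma kb_disj: assumes "kb {p. P p}" "kb {p. Q p}" shows "kb {p. P p \<or> Q p}"
proof -
  obtain a b :: 'k where ab: "a \<noteq> b" using ex_gt by (metis O.less_irrefl)
  have "kb {p. \<exists>k. if k = a then P p else Q p}"
  proof (rule kb_ex)
    show "kb {p. if k = a then P p else Q p}" for k using assms by (cases "k = a") simp_all
  qed
  moreover have "(\<exists>k. if k = a then P p else Q p) \<longleftrightarrow> P p \<or> Q p" for p using ab by auto
  ultimately show ?thesis by simp
qed

lemma kb_imp: "kb {p. P p} \<Longrightarrow> kb {p. Q p} \<Longrightarrow> kb {p. P p \<longrightarrow> Q p}"
  unfolding imp_conv_disj by (intro kb_disj kb_not)

lemma kb_conj: "kb {p. P p} \<Longrightarrow> kb {p. Q p} \<Longrightarrow> kb {p. P p \<and> Q p}"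
  using kb_not[OF kb_disj[OF kb_not kb_not]] by simp

lemma kb_coord_eq: "kb {p. fst p x = snd p x}"
proof (rule kappa_borel.open)
  have "{p. fst p x = snd p x} = ({\<eta>. \<eta> x = True} \<times> {\<eta>. \<eta> x = True}) \<union> ({\<eta>. \<eta> x = False} \<times> {\<eta>. \<eta> x = False})"
    by auto
  moreover have "openin (prod_topology (cantor_topology \<kappa>) (cantor_topology \<kappa>)) ({\<eta>. \<eta> x = v} \<times> {\<eta>. \<eta> x = v})" for v
    unfolding openin_prod_Times_iff using opn_coord by blast
  ultimately show "openin (prod_topology (cantor_topology \<kappa>) (cantor_topology \<kappa>)) {p. fst p x = snd p x}"
    by (simp only: openin_Un)
qed

text \<open>Borelness is read off from the form of a definition: formulas built from coordinate
  equalities by connectives and by quantifiers over \<kappa> define Borel sets.\<close>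

lemmas kb_intros = kb_const kb_not kb_ex kb_all kb_imp kb_conj kb_disj kb_coord_eq

lemma kb_rowrel: "kb rowrel"
proof -
  have "rowrel = {p. \<forall>r. \<exists>b. \<forall>\<gamma>. b \<sqsubseteq> \<gamma> \<longrightarrow> fst p (e False r \<gamma>) = snd p (e False r \<gamma>)}"
    unfolding rowrel_def tpart_def by auto
  also have "kb \<dots>" by (intro kb_intros)
  finally show ?thesis .
qed

lemma kb_econst: "kb {p. econst a (tpart (fst p) r) (tpart (snd p) r)}"
proof -
  \<comment> \<open>The quantifier over the Boolean value in \<open>econst\<close> is written as a
    disjunction, because \<open>kb_ex\<close> concerns quantifiers over \<kappa>.\<close>
  have "kb {p. (\<exists>b. b \<sqsubset> a) \<longrightarrow> (\<exists>b. b \<sqsubset> a \<and>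
      ((\<forall>\<gamma>. b \<sqsubseteq> \<gamma> \<and> \<gamma> \<sqsubset> a \<longrightarrow> \<not> fst p (e False r \<gamma>) = snd p (e False r \<gamma>)) \<or>
       (\<forall>\<gamma>. b \<sqsubseteq> \<gamma> \<and> \<gamma> \<sqsubset> a \<longrightarrow> fst p (e False r \<gamma>) = snd p (e False r \<gamma>))))}"
    by (intro kb_intros)
  then show ?thesis unfolding econst_def tpart_def ex_bool_eq by (simp add: conj_disj_distribL)
qed

lemma kb_locrel: "kb (locrel X k)"
proof -
  have "locrel X k = {p. \<forall>m. k \<sqsubseteq> m \<longrightarrow> (\<forall>x. fst p (e True m x) = snd p (e True m x)) \<and>
     (m \<notin> X \<longrightarrow> (\<forall>r a. a \<in> S m \<longrightarrow> econst a (tpart (fst p) r) (tpart (snd p) r)))}"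
    unfolding locrel_def upart_def by (auto simp: fun_eq_iff)
  also have "kb \<dots>" by (intro kb_intros kb_econst)
  finally show ?thesis .
qed

lemma erel_borel: "erel X \<in> borel_equivs \<kappa>"
proof -
  have "kb {p. \<exists>k. p \<in> locrel X k}" by (rule kb_ex) (simp add: kb_locrel)
  then have "kb {p. (\<exists>k. p \<in> locrel X k) \<and> p \<in> rowrel}" by (rule kb_conj) (simp add: kb_rowrel)
  moreover have "{p. (\<exists>k. p \<in> locrel X k) \<and> p \<in> rowrel} = erel X" unfolding erel_def by auto
  ultimately show ?thesis unfolding borel_equivs_def using equiv_erel by simp
qed

text \<open>A basic neighbourhood restricts fewer than \<kappa> coordinates, so their moduli of
  continuity have a common bound.\<close>

lemma continuous_imp_borel_function:
  assumes "\<And>\<eta> x. \<exists>\<delta>. \<forall>\<xi>. agree \<delta> \<eta> \<xi> \<longrightarrow> f \<xi> x = f \<eta> x"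
  shows "borel_function \<kappa> f"
  unfolding borel_function_def
proof (intro allI impI kappa_borel.open)
  fix U assume U: "opn U"
  show "opn (f -` U)" unfolding opn_iff
  proof
    fix \<eta> assume "\<eta> \<in> f -` U"
    then obtain \<alpha> where \<alpha>: "\<And>\<xi>. agree \<alpha> (f \<eta>) \<xi> \<Longrightarrow> \<xi> \<in> U" using U unfolding opn_iff by blast
    obtain d where d: "\<And>x \<xi>. agree (d x) \<eta> \<xi> \<Longrightarrow> f \<xi> x = f \<eta> x" using assms[of \<eta>] by metis
    obtain \<delta> where \<delta>: "\<And>x. x \<sqsubset> \<alpha> \<Longrightarrow> d x \<sqsubset> \<delta>"
      using bdd_image[OF bdd_underS(1), of d \<alpha>] unfolding bdd_def by blast
    have "agree \<alpha> (f \<eta>) (f \<xi>)" if "agree \<delta> \<eta> \<xi>" for \<xi>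
      unfolding agree_def using d \<delta> agree_mono_lt[OF that] by metis
    then show "\<exists>\<delta>. \<forall>\<xi>. agree \<delta> \<eta> \<xi> \<longrightarrow> \<xi> \<in> f -` U" using \<alpha> by blast
  qed
qed

section \<open>The reduction when \<open>X - Y\<close> is bounded\<close>

definition rep :: "'k \<Rightarrow> ('k \<Rightarrow> bool) \<Rightarrow> 'k \<Rightarrow> bool" where "rep a p = (SOME q. econst a p q)"

lemma rep_eq_iff: "rep a p = rep a q \<longleftrightarrow> econst a p q"
proof
  assume "rep a p = rep a q"
  moreover have "econst a p (rep a p)" for p unfolding rep_def using someI[of "econst a p", OF econst_refl] .
  ultimately show "econst a p q" using econst_trans econst_sym by metis
next
  assume "econst a p q"
  then have "econst a p = econst a q" using econst_trans econst_sym by blast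
  then show "rep a p = rep a q" unfolding rep_def by simp
qed

text \<open>The chosen representatives turn the local relations into equalities, which are recorded
  in the second matrix next to its old rows. Agreement of the new \<open>m\<close>-th rows then
  amounts to the complete \<open>m\<close>-th clause of \<open>locrel X\<close>.\<close>

definition red :: "'k set \<Rightarrow> ('k \<Rightarrow> bool) \<Rightarrow> 'k \<Rightarrow> bool" where
  "red X \<eta> z \<longleftrightarrow> (\<exists>r \<gamma>. z = e False r \<gamma> \<and> tpart \<eta> r \<gamma>) \<or>
     (\<exists>m y. z = e True m (\<psi> (Inl y)) \<and> upart \<eta> m y) \<or>
     (\<exists>m r a \<gamma>. z = e True m (\<psi> (Inr (r, a, \<gamma>))) \<and> m \<notin> X \<and> a \<in> S m \<and> rep a (tpart \<eta> r) \<gamma>)"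

lemma tpart_red: "tpart (red X \<eta>) = tpart \<eta>"
  unfolding red_def by (auto simp: fun_eq_iff tpart_def[of "\<lambda>z. _ z"])

lemma upart_red:
  "upart (red X \<eta>) m (\<psi> (Inl y)) \<longleftrightarrow> upart \<eta> m y"
  "upart (red X \<eta>) m (\<psi> (Inr (r, a, \<gamma>))) \<longleftrightarrow> m \<notin> X \<and> a \<in> S m \<and> rep a (tpart \<eta> r) \<gamma>"
  "x \<notin> range \<psi> \<Longrightarrow> \<not> upart (red X \<eta>) m x"
  unfolding red_def upart_def[of "\<lambda>z. _ z"] using \<psi>_inj by (auto simp: inj_eq)

lemma upart_red_eq_iff:
  "upart (red X \<eta>) m = upart (red X \<xi>) m \<longleftrightarrow> upart \<eta> m = upart \<xi> m \<and>
     (m \<notin> X \<longrightarrow> (\<forall>r. \<forall>a\<in>S m. econst a (tpart \<eta> r) (tpart \<xi> r)))" (is "?l \<longleftrightarrow> ?r")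
proof
  assume l: ?l
  have "upart \<eta> m y = upart \<xi> m y" for y using l upart_red(1) by metis
  moreover have "rep a (tpart \<eta> r) \<gamma> = rep a (tpart \<xi> r) \<gamma>" if "m \<notin> X" "a \<in> S m" for r a \<gamma>
    using l upart_red(2) that by metis
  ultimately show ?r unfolding rep_eq_iff[symmetric] by blast
next
  assume r: ?r
  show ?l
  proof
    fix x
    show "upart (red X \<eta>) m x = upart (red X \<xi>) m x"
    proof (cases "x \<in> range \<psi>")
      case True
      then obtain z where "x = \<psi> z" by blast
      then show ?thesis using r unfolding rep_eq_iff[symmetric]
        by (cases z) (auto simp: upart_red)
    qed (simp add: upart_red)
  qed
qed

lemma bdd_row: "bdd {e b r \<gamma> |\<gamma>. \<gamma> \<sqsubset> a}"
proof -
  have "{e b r \<gamma> |\<gamma>. \<gamma> \<sqsubset> a} = e b r ` underS \<kappa> a" by blast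
  then show ?thesis using bdd_image[OF bdd_underS(1)] by simp
qed

lemma agree_tpart: "\<exists>\<delta>. \<forall>\<eta> \<xi>. agree \<delta> \<eta> \<xi> \<longrightarrow> (\<forall>\<gamma>. \<gamma> \<sqsubset> a \<longrightarrow> tpart \<eta> r \<gamma> = tpart \<xi> r \<gamma>)"
proof -
  obtain \<delta> where "\<forall>x\<in>{e False r \<gamma> |\<gamma>. \<gamma> \<sqsubset> a}. x \<sqsubset> \<delta>" using bdd_row unfolding bdd_def by blast
  then show ?thesis unfolding agree_def tpart_def by blast
qed

text \<open>Although representatives are chosen arbitrarily, the class at \<open>a\<close>, and with
  it the entire representative, depends only on the part of the row below \<open>a\<close>. So each
  output coordinate is determined by a bounded part of the input.\<close>

lemma borel_red: "borel_function \<kappa> (red X)"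
proof (rule continuous_imp_borel_function)
  fix \<eta> z
  consider r \<gamma> where "z = e False r \<gamma>" | m y where "z = e True m (\<psi> (Inl y))"
    | m r a \<gamma> where "z = e True m (\<psi> (Inr (r, a, \<gamma>)))" | m x where "z = e True m x" "x \<notin> range \<psi>"
    | "\<nexists>b r \<gamma>. z = e b r \<gamma>" by (metis (full_types) rangeE surj_pair sum.exhaust)
  then show "\<exists>\<delta>. \<forall>\<xi>. agree \<delta> \<eta> \<xi> \<longrightarrow> red X \<xi> z = red X \<eta> z"
  proof cases
    case 1
    obtain \<delta> where "z \<sqsubset> \<delta>" using ex_gt by blast
    moreover have "red X \<xi> z = \<xi> z" for \<xi> using tpart_red 1 unfolding tpart_def by metis
    ultimately show ?thesis unfolding agree_def by metis
  next
    case (2 m y)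
    obtain \<delta> where "e True m y \<sqsubset> \<delta>" using ex_gt by blast
    moreover have "red X \<xi> z = \<xi> (e True m y)" for \<xi> using upart_red(1) 2 unfolding upart_def by metis
    ultimately show ?thesis unfolding agree_def by metis
  next
    case (3 m r a \<gamma>)
    obtain \<delta> where "\<And>\<eta> \<xi> \<gamma>. agree \<delta> \<eta> \<xi> \<Longrightarrow> \<gamma> \<sqsubset> a \<Longrightarrow> tpart \<eta> r \<gamma> = tpart \<xi> r \<gamma>"
      using agree_tpart[of a r] by blast
    then have "agree \<delta> \<eta> \<xi> \<Longrightarrow> econst a (tpart \<xi> r) (tpart \<eta> r)" for \<xi>
      using econst_cong[of a "tpart \<eta> r" "tpart \<xi> r" "tpart \<eta> r" "tpart \<eta> r"] econst_refl by blast
    moreover have "red X \<xi> z \<longleftrightarrow> m \<notin> X \<and> a \<in> S m \<and> rep a (tpart \<xi> r) \<gamma>" for \<xi>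
      using upart_red(2) 3 unfolding upart_def by metis
    ultimately show ?thesis using rep_eq_iff by metis
  next
    case (4 m x)
    then have "\<not> red X \<xi> z" for \<xi> using upart_red(3) unfolding upart_def by metis
    then show ?thesis by blast
  next
    case 5
    then have "\<not> red X \<xi> z" for \<xi> unfolding red_def by blast
    then show ?thesis by blast
  qed
qed

lemma erel_reducible:
  assumes "subset_mod_bounded \<kappa> X Y"
  shows "borel_reducible \<kappa> (erel X) (erel Y)"
proof -
  obtain \<alpha> where \<alpha>: "X - Y \<subseteq> underS \<kappa> \<alpha>" using assms unfolding subset_mod_bounded_def by blast
  have row: "(red X \<eta>, red X \<xi>) \<in> rowrel \<longleftrightarrow> (\<eta>, \<xi>) \<in> rowrel" for \<eta> \<xi>
    unfolding rowrel_def by (simp add: tpart_red)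
  \<comment> \<open>This direction keeps \<open>k\<close>: agreement of the new rows encodes the
    local clauses for \<open>X\<close>. The bound on \<open>X - Y\<close> enters only in the other
    direction, where the local clauses for \<open>Y\<close> have to follow from those for
    \<open>X\<close>.\<close>
  have "(\<eta>, \<xi>) \<in> locrel X k" if "(red X \<eta>, red X \<xi>) \<in> locrel Y k" for \<eta> \<xi> k
    using that unfolding locrel_def by (simp add: upart_red_eq_iff)
  moreover have "(red X \<eta>, red X \<xi>) \<in> locrel Y l" if k: "(\<eta>, \<xi>) \<in> locrel X k" and l: "k \<sqsubset> l" "\<alpha> \<sqsubset> l" for \<eta> \<xi> k l
  proof -
    have *: "m \<notin> Y \<Longrightarrow> m \<notin> X" if "l \<sqsubseteq> m" for m using \<alpha> that l(2) O.less_le_trans O.less_asym by blast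
    show ?thesis using locrel_mono[OF k O.less_imp_le[OF l(1)]] *
      unfolding locrel_def by (simp add: upart_red_eq_iff tpart_red)
  qed
  ultimately have "(\<exists>k. (\<eta>, \<xi>) \<in> locrel X k) \<longleftrightarrow> (\<exists>k. (red X \<eta>, red X \<xi>) \<in> locrel Y k)" for \<eta> \<xi>
    using ex_ge2[of _ \<alpha>] by blast
  then have "(\<eta>, \<xi>) \<in> erel X \<longleftrightarrow> (red X \<eta>, red X \<xi>) \<in> erel Y" for \<eta> \<xi>
    unfolding erel_def using row by simp
  then show ?thesis unfolding borel_reducible_def using borel_red by blast
qed

subsection \<open>Admissible changes\<close>

definition good_row :: "'k set \<Rightarrow> 'k set \<Rightarrow> bool" where
  "good_row X A \<longleftrightarrow> bdd A \<and> (\<forall>m a. m \<notin> X \<longrightarrow> a \<in> S m \<longrightarrow> econst a (\<lambda>\<gamma>. \<gamma> \<in> A) (\<lambda>_. False))"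

definition row :: "'k set \<Rightarrow> 'k \<Rightarrow> 'k set" where "row h r = {\<gamma>. e False r \<gamma> \<in> h}"

text \<open>The admissible changes, which preserve the \<open>erel X\<close> class by
  \<open>good_erel\<close>. Each row has to be bounded but the whole set does not: the limit built
  in \<open>ex_settled\<close> may involve \<kappa> many rows.\<close>

definition good :: "'k set \<Rightarrow> 'k set \<Rightarrow> bool" where
  "good X h \<longleftrightarrow> (\<forall>x\<in>h. \<exists>r \<gamma>. x = e False r \<gamma>) \<and> (\<forall>r. good_row X (row h r))"

lemma tpart_flip: "tpart (flip h \<eta>) r \<gamma> \<longleftrightarrow> tpart \<eta> r \<gamma> \<noteq> (\<gamma> \<in> row h r)"
  unfolding tpart_def flip_def row_def by simp

lemma upart_flip: "good X h \<Longrightarrow> upart (flip h \<eta>) = upart \<eta>"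
  unfolding upart_def flip_def good_def by (fastforce simp: fun_eq_iff)

lemma good_erel: assumes "good X h" shows "(\<eta>, flip h \<eta>) \<in> erel X"
proof -
  have "econst a (tpart \<eta> r) (tpart (flip h \<eta>) r)" if "m \<notin> X" "a \<in> S m" for m a r
  proof -
    have "econst a (\<lambda>\<gamma>. \<gamma> \<in> row h r) (\<lambda>_. False)"
      using assms that unfolding good_def good_row_def by blast
    then show ?thesis by (subst econst_diff_cong) (auto simp: tpart_flip)
  qed
  then have "(\<eta>, flip h \<eta>) \<in> locrel X k" for k
    unfolding locrel_def using upart_flip[OF assms] by auto
  moreover have "\<exists>b. \<forall>\<gamma>. b \<sqsubseteq> \<gamma> \<longrightarrow> tpart \<eta> r \<gamma> = tpart (flip h \<eta>) r \<gamma>" for r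
  proof -
    obtain b where "\<forall>\<gamma>\<in>row h r. \<gamma> \<sqsubset> b" using assms unfolding good_def good_row_def bdd_def by blast
    then show ?thesis unfolding tpart_flip using O.leD by blast
  qed
  ultimately show ?thesis unfolding erel_def rowrel_def by blast
qed

lemma row_sym_diff: "row (sym_diff g h) r = sym_diff (row g r) (row h r)"
  unfolding row_def by auto

lemma good_row_sym_diff:
  assumes "good_row X A" "good_row X B" shows "good_row X (sym_diff A B)"
proof -
  have "bdd (sym_diff A B)"
    by (rule bdd_subset[OF bdd_Un[of A B]]) (use assms in \<open>auto simp: good_row_def\<close>)
  moreover have "econst a (\<lambda>\<gamma>. \<gamma> \<in> sym_diff A B) (\<lambda>_. False)" if "m \<notin> X" "a \<in> S m" for m a
  proof -
    have "econst a (\<lambda>\<gamma>. \<gamma> \<in> A) (\<lambda>_. False)" "econst a (\<lambda>\<gamma>. \<gamma> \<in> B) (\<lambda>_. False)"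
      using assms that unfolding good_row_def by blast+
    then have "econst a (\<lambda>\<gamma>. \<gamma> \<in> A) (\<lambda>\<gamma>. \<gamma> \<in> B)" using econst_trans econst_sym by blast
    then show ?thesis by (subst econst_diff_cong) auto
  qed
  ultimately show ?thesis unfolding good_row_def by blast
qed

lemma good_sym_diff: "good X g \<Longrightarrow> good X h \<Longrightarrow> good X (sym_diff g h)"
  unfolding good_def row_sym_diff using good_row_sym_diff by blast

lemma good_disjoint_Un: assumes "good X g" "good X h" "g \<inter> h = {}" shows "good X (g \<union> h)"
proof -
  have "g \<union> h = sym_diff g h" using assms(3) by auto
  then show ?thesis using good_sym_diff[OF assms(1,2)] by simp
qed

text \<open>Below a point up to \<open>lo\<close> or beyond \<open>hi\<close> the interval is
  eventually absent; below a point in between it is eventually everything. The latter case is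
  admissible because \<open>econst\<close> asks for constancy and not for vanishing.\<close>

lemma good_row_interval: "good_row X {\<gamma>. lo \<sqsubseteq> \<gamma> \<and> \<gamma> \<sqsubset> hi}"
proof -
  have "econst a (\<lambda>\<gamma>. \<gamma> \<in> {\<gamma>. lo \<sqsubseteq> \<gamma> \<and> \<gamma> \<sqsubset> hi}) (\<lambda>_. False)" for a
    unfolding econst_def
  proof (intro impI)
    assume ne: "\<exists>b. b \<sqsubset> a"
    consider "a \<sqsubseteq> lo" | "lo \<sqsubset> a" "a \<sqsubseteq> hi" | "hi \<sqsubset> a" using O.not_le by blast
    then have "\<exists>b v. b \<sqsubset> a \<and> (\<forall>\<gamma>. b \<sqsubseteq> \<gamma> \<and> \<gamma> \<sqsubset> a \<longrightarrow> (lo \<sqsubseteq> \<gamma> \<and> \<gamma> \<sqsubset> hi) = v)"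
    proof cases
      case 1
      then have "\<not> lo \<sqsubseteq> \<gamma>" if "\<gamma> \<sqsubset> a" for \<gamma> using that O.less_le_trans O.leD by blast
      then show ?thesis using ne by (metis (full_types))
    next
      case 2
      then have "\<gamma> \<sqsubset> hi" if "\<gamma> \<sqsubset> a" for \<gamma> using that O.less_le_trans by blast
      then show ?thesis using 2(1) by (metis (full_types))
    next
      case 3
      then have "\<not> \<gamma> \<sqsubset> hi" if "hi \<sqsubseteq> \<gamma>" for \<gamma> using that O.leD by blast
      then show ?thesis using 3 by (metis (full_types))
    qed
    then show "\<exists>b v. b \<sqsubset> a \<and> (\<forall>\<gamma>. b \<sqsubseteq> \<gamma> \<and> \<gamma> \<sqsubset> a \<longrightarrow> ((\<gamma> \<in> {\<gamma>. lo \<sqsubseteq> \<gamma> \<and> \<gamma> \<sqsubset> hi}) \<noteq> False) = v)" by simp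
  qed
  moreover have "bdd {\<gamma>. lo \<sqsubseteq> \<gamma> \<and> \<gamma> \<sqsubset> hi}" unfolding bdd_def by blast
  ultimately show ?thesis unfolding good_row_def by blast
qed

lemma good_row_empty: "good_row X {}"
  unfolding good_row_def bdd_def using econst_refl[of _ "\<lambda>_. False"] by simp

lemma good_empty: "good X {}"
  unfolding good_def row_def using good_row_empty by simp

lemma good_interval: "good X {e False r \<gamma> |\<gamma>. lo \<sqsubseteq> \<gamma> \<and> \<gamma> \<sqsubset> hi}" (is "good X ?h")
proof -
  have "row ?h r' = (if r' = r then {\<gamma>. lo \<sqsubseteq> \<gamma> \<and> \<gamma> \<sqsubset> hi} else {})" for r'
    unfolding row_def by auto
  then show ?thesis unfolding good_def using good_row_interval good_row_empty by auto
qed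

lemma bdd_interval: "bdd {e False r \<gamma> |\<gamma>. lo \<sqsubseteq> \<gamma> \<and> \<gamma> \<sqsubset> hi}"
  by (rule bdd_subset[OF bdd_row[of False r hi]]) blast

text \<open>A failure is witnessed by one coordinate of the second matrices or by one row of the
  first ones below a single point \<open>a\<close>, hence by bounded parts of both
  arguments.\<close>

lemma locrel_decided:
  assumes "(\<eta>, \<xi>) \<notin> locrel Y k"
  shows "\<exists>\<alpha>. \<forall>p q. agree \<alpha> \<eta> p \<longrightarrow> agree \<alpha> \<xi> q \<longrightarrow> (p, q) \<notin> locrel Y k"
proof -
  obtain m where m: "k \<sqsubseteq> m"
    "upart \<eta> m \<noteq> upart \<xi> m \<or> (m \<notin> Y \<and> (\<exists>r. \<exists>a\<in>S m. \<not> econst a (tpart \<eta> r) (tpart \<xi> r)))"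
    using assms unfolding locrel_def by blast
  from m(2) show ?thesis
  proof
    assume "upart \<eta> m \<noteq> upart \<xi> m"
    then obtain x where x: "\<eta> (e True m x) \<noteq> \<xi> (e True m x)" unfolding upart_def by blast
    obtain \<alpha> where \<alpha>: "e True m x \<sqsubset> \<alpha>" using ex_gt by blast
    have "(p, q) \<notin> locrel Y k" if "agree \<alpha> \<eta> p" "agree \<alpha> \<xi> q" for p q
    proof -
      have "upart p m x \<noteq> upart q m x" using x \<alpha> that unfolding agree_def upart_def by blast
      then show ?thesis using m(1) unfolding locrel_def by auto
    qed
    then show ?thesis by blast
  next
    assume "m \<notin> Y \<and> (\<exists>r. \<exists>a\<in>S m. \<not> econst a (tpart \<eta> r) (tpart \<xi> r))"
    then obtain r a where a: "m \<notin> Y" "a \<in> S m" "\<not> econst a (tpart \<eta> r) (tpart \<xi> r)" by blast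
    obtain \<alpha> where \<alpha>: "\<And>\<eta> \<xi> \<gamma>. agree \<alpha> \<eta> \<xi> \<Longrightarrow> \<gamma> \<sqsubset> a \<Longrightarrow> tpart \<eta> r \<gamma> = tpart \<xi> r \<gamma>"
      using agree_tpart[of a r] by blast
    have "(p, q) \<notin> locrel Y k" if "agree \<alpha> \<eta> p" "agree \<alpha> \<xi> q" for p q
    proof -
      have "\<not> econst a (tpart p r) (tpart q r)"
        using a(3) econst_cong[of a "tpart \<eta> r" "tpart p r" "tpart \<xi> r" "tpart q r"] \<alpha> that by blast
      then show ?thesis using m(1) a(1,2) unfolding locrel_def by blast
    qed
    then show ?thesis by blast
  qed
qed

lemma agree_flip_cols:
  assumes "\<forall>x\<in>h. \<exists>\<gamma>. x = e b r \<gamma> \<and> \<delta> \<sqsubseteq> \<gamma>"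
  shows "agree \<delta> \<eta> (flip h \<eta>)"
proof (rule agree_flip_off)
  fix x assume "x \<in> h"
  then obtain \<gamma> where "x = e b r \<gamma>" "\<delta> \<sqsubseteq> \<gamma>" using assms by blast
  then show "\<delta> \<sqsubseteq> x" using e_ge_col O.order.trans by blast
qed

lemma agree_flip_rows:
  assumes "\<forall>x\<in>h. \<exists>r \<gamma>. x = e b r \<gamma> \<and> \<delta> \<sqsubseteq> r"
  shows "agree \<delta> \<eta> (flip h \<eta>)"
proof (rule agree_flip_off)
  fix x assume "x \<in> h"
  then obtain r \<gamma> where "x = e b r \<gamma>" "\<delta> \<sqsubseteq> r" using assms by blast
  then show "\<delta> \<sqsubseteq> x" using e_ge_row O.order.trans by blast
qed

end

subsection \<open>Non-reducibility\<close>

text \<open>The situation to be refuted: \<open>f\<close> reduces \<open>erel X\<close> to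
  \<open>erel Y\<close> although \<open>X - Y\<close> is unbounded. \<open>C\<close> is comeager and
  closed under bounded changes, and \<open>f\<close> is continuous on it.\<close>

locale reduction = coded \<kappa> e S \<psi>
  for \<kappa> :: "'k rel" and e :: "bool \<Rightarrow> 'k \<Rightarrow> 'k \<Rightarrow> 'k" and S \<psi> +
  fixes X Y :: "'k set" and f :: "('k \<Rightarrow> bool) \<Rightarrow> 'k \<Rightarrow> bool"
    and D :: "'k \<Rightarrow> ('k \<Rightarrow> bool) set" and C :: "('k \<Rightarrow> bool) set"
  assumes C_eq: "C = (\<Inter>i. D i)" and D_opn: "opn (D i)" and D_dns: "dns (D i)"
    and C_flip: "bdd h \<Longrightarrow> \<eta> \<in> C \<Longrightarrow> flip h \<eta> \<in> C"
    and f_cont: "\<eta> \<in> C \<Longrightarrow> \<exists>\<delta>. \<forall>\<xi>\<in>C. agree \<delta> \<eta> \<xi> \<longrightarrow> f \<xi> x = f \<eta> x"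
    and f_red: "(\<eta>, \<xi>) \<in> erel X \<longleftrightarrow> (f \<eta>, f \<xi>) \<in> erel Y"
    and unbounded: "\<exists>i\<in>X - Y. a \<sqsubseteq> i"
begin

lemma dense_C: "\<exists>\<xi>\<in>C. agree \<delta> \<eta> \<xi>"
  unfolding C_eq using D_opn D_dns by (rule baire)

lemma comeager_C: "comeager C"
  unfolding comeager_def C_eq by (intro exI[of _ D] conjI allI D_opn D_dns subset_refl)

lemma f_cont_bdd: assumes "\<eta> \<in> C" shows "\<exists>\<delta>. \<forall>\<xi>\<in>C. agree \<delta> \<eta> \<xi> \<longrightarrow> agree \<alpha> (f \<eta>) (f \<xi>)"
proof -
  have "\<forall>x. \<exists>\<delta>. \<forall>\<xi>\<in>C. agree \<delta> \<eta> \<xi> \<longrightarrow> f \<xi> x = f \<eta> x" using f_cont[OF assms] by blast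
  from choice[OF this] obtain d where d: "\<And>x \<xi>. \<xi> \<in> C \<Longrightarrow> agree (d x) \<eta> \<xi> \<Longrightarrow> f \<xi> x = f \<eta> x" by blast
  obtain \<delta> where \<delta>: "\<And>x. x \<sqsubset> \<alpha> \<Longrightarrow> d x \<sqsubset> \<delta>"
    using bdd_image[OF bdd_underS(1), of d \<alpha>] unfolding bdd_def by blast
  have "agree \<alpha> (f \<eta>) (f \<xi>)" if "\<xi> \<in> C" "agree \<delta> \<eta> \<xi>" for \<xi>
    unfolding agree_def using d[OF that(1)] \<delta> agree_mono_lt[OF that(2)] by metis
  then show ?thesis by blast
qed

lemma decided:
  assumes "t \<in> C" "s \<in> C" "(f t, f s) \<notin> locrel Y k"
  obtains \<delta> where "\<And>t' s'. t' \<in> C \<Longrightarrow> s' \<in> C \<Longrightarrow> agree \<delta> t t' \<Longrightarrow> agree \<delta> s s' \<Longrightarrow> (f t', f s') \<notin> locrel Y k"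
proof -
  obtain \<alpha> where \<alpha>: "\<And>p q. agree \<alpha> (f t) p \<Longrightarrow> agree \<alpha> (f s) q \<Longrightarrow> (p, q) \<notin> locrel Y k"
    using locrel_decided[OF assms(3)] by blast
  obtain d1 where d1: "\<And>t'. t' \<in> C \<Longrightarrow> agree d1 t t' \<Longrightarrow> agree \<alpha> (f t) (f t')" using f_cont_bdd[OF assms(1)] by blast
  obtain d2 where d2: "\<And>t'. t' \<in> C \<Longrightarrow> agree d2 s t' \<Longrightarrow> agree \<alpha> (f s) (f t')" using f_cont_bdd[OF assms(2)] by blast
  obtain d where d: "d1 \<sqsubset> d" "d2 \<sqsubset> d" using ex_ge2 by blast
  show ?thesis
  proof (rule that)
    show "(f t', f s') \<notin> locrel Y k" if "t' \<in> C" "s' \<in> C" "agree d t t'" "agree d s s'" for t' s'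
      using \<alpha> d1 d2 that agree_mono_lt d by blast
  qed
qed

text \<open>Beyond \<open>\<delta>\<close> and near \<open>t\<close>, changes in fresh rows cannot affect the local clauses with index at least \<open>\<beta>\<close>.\<close>

definition settled :: "'k \<Rightarrow> ('k \<Rightarrow> bool) \<Rightarrow> 'k \<Rightarrow> bool" where
  "settled \<delta> t \<beta> \<longleftrightarrow> t \<in> C \<and> (\<forall>s\<in>C. agree \<delta> t s \<longrightarrow>
     (\<forall>h. good X h \<longrightarrow> bdd h \<longrightarrow> (\<forall>r \<gamma>. e False r \<gamma> \<in> h \<longrightarrow> \<delta> \<sqsubseteq> r) \<longrightarrow> (f s, f (flip h s)) \<in> locrel Y \<beta>))"

text \<open>Extends a given change \<open>h\<close> so that the images become unrelated. Applied to
  \<open>flip h t\<close>, the failure of \<open>settled\<close> gives \<open>s\<close> and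
  \<open>g\<close> with \<open>f s\<close> and \<open>f (flip g s)\<close> unrelated. So
  \<open>f (flip h s)\<close> is unrelated to one of the two, and the new change is empty or
  \<open>g\<close> accordingly.\<close>

lemma not_settled_step:
  assumes ns: "\<And>t. \<not> settled \<delta> t \<beta>" and t: "t \<in> C" and h: "bdd h"
  obtains t' h' where "t' \<in> C" "agree \<delta> t t'" "good X h'" "bdd h'" "\<And>r \<gamma>. e False r \<gamma> \<in> h' \<Longrightarrow> \<delta> \<sqsubseteq> r"
    "(f t', f (flip h' (flip h t'))) \<notin> locrel Y \<beta>"
proof -
  have "flip h t \<in> C" using C_flip t h by blast
  then obtain s g where s: "s \<in> C" "agree \<delta> (flip h t) s" and g: "good X g" "bdd g"
      "\<And>r \<gamma>. e False r \<gamma> \<in> g \<Longrightarrow> \<delta> \<sqsubseteq> r" "(f s, f (flip g s)) \<notin> locrel Y \<beta>"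
    using ns[of "flip h t"] unfolding settled_def by blast
  have t': "flip h s \<in> C" "agree \<delta> t (flip h s)"
    using C_flip[OF h s(1)] s(2) agree_flip[of \<delta> h t "flip h s"] by simp_all
  show ?thesis
  proof (cases "(f (flip h s), f s) \<in> locrel Y \<beta>")
    case True
    then have "(f (flip h s), f (flip g s)) \<notin> locrel Y \<beta>" using g(4) locrel_trans locrel_sym by blast
    then show ?thesis using that[OF t' g(1-3)] by simp
  next
    case False
    have "bdd {}" unfolding bdd_def by simp
    then show ?thesis using that[OF t' good_empty] False by simp
  qed
qed

lemma bdd_insert: "bdd A \<Longrightarrow> bdd (insert a A)"
  using bdd_Un[of A "{a}"] ex_gt[of a] unfolding bdd_def[of "{a}"] by simp

text \<open>Otherwise a chain of length \<kappa> destroys \<open>locrel Y i\<close> at stage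
  \<open>i\<close>, always by changes in rows beyond the current length. A row is thus never touched
  again once it has been changed, so the union of all changes is admissible. It yields equivalent
  points whose images are related by no \<open>locrel Y j\<close>.\<close>

lemma ex_settled: "\<exists>\<delta> t \<beta>. settled \<delta> t \<beta>"
proof (rule ccontr)
  assume "\<nexists>\<delta> t \<beta>. settled \<delta> t \<beta>"
  then have ns: "\<not> settled \<delta> t \<beta>" for \<delta> t \<beta> by blast
  define P where "P = {(\<delta>, t, h). t \<in> C \<and> good X h \<and> h \<subseteq> underS \<kappa> \<delta>}"
  define R where "R = (\<lambda>(\<delta>, t, h) (\<delta>', t', h'). \<delta> \<sqsubseteq> \<delta>' \<and> agree \<delta> t t' \<and> h \<subseteq> h' \<and>
    (\<forall>r \<gamma>. e False r \<gamma> \<in> h' \<longrightarrow> e False r \<gamma> \<in> h \<or> \<delta> \<sqsubseteq> r))"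
  \<comment> \<open>Both the point and its changed version are forced into \<open>D i\<close>, so
    that both limits lie in \<open>C\<close>, and the failure of \<open>locrel Y i\<close> is
    decided for all their extensions in \<open>C\<close>.\<close>
  define Q where "Q = (\<lambda>i (\<delta>, t, h). i \<sqsubset> \<delta> \<and> (\<forall>s. agree \<delta> t s \<longrightarrow> s \<in> D i) \<and>
    (\<forall>s. agree \<delta> (flip h t) s \<longrightarrow> s \<in> D i) \<and>
    (\<forall>t'\<in>C. \<forall>s'\<in>C. agree \<delta> t t' \<longrightarrow> agree \<delta> (flip h t) s' \<longrightarrow> (f t', f s') \<notin> locrel Y i))"
  have good_UN: "good X (\<Union>j\<in>J. h j)"
    if P: "\<And>j. j \<in> J \<Longrightarrow> (\<delta> j, t j, h j) \<in> P"
      and R: "\<And>j j'. j \<in> J \<Longrightarrow> j' \<in> J \<Longrightarrow> j \<sqsubset> j' \<Longrightarrow> R (\<delta> j, t j, h j) (\<delta> j', t j', h j')"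
    for J :: "'k set" and \<delta> t h
    unfolding good_def
  proof (intro conjI allI ballI)
    fix x assume "x \<in> (\<Union>j\<in>J. h j)"
    then show "\<exists>r \<gamma>. x = e False r \<gamma>" using P unfolding P_def good_def by blast
  next
    fix r
    show "good_row X (row (\<Union>j\<in>J. h j) r)"
    proof (cases "row (\<Union>j\<in>J. h j) r = {}")
      case True
      then show ?thesis using good_row_empty by simp
    next
      case False
      then obtain j \<gamma> where j: "j \<in> J" "e False r \<gamma> \<in> h j" unfolding row_def by blast
      then have r: "r \<sqsubset> \<delta> j" using P[OF j(1)] O.le_less_trans[OF e_ge_row] unfolding P_def by blast
      have "row (h j') r \<subseteq> row (h j) r" if "j' \<in> J" for j'
        using R[OF j(1) that] R[OF that j(1)] r O.less_linear[of j j'] O.leD unfolding R_def row_def by fastforce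
      then have "row (\<Union>j\<in>J. h j) r = row (h j) r" using j(1) unfolding row_def by blast
      then show ?thesis using P[OF j(1)] unfolding P_def good_def by simp
    qed
  qed
  have agr: "\<exists>t'. \<forall>j\<in>J. agree (\<delta> j) (t j) t'"
    if R: "\<And>j j'. j \<in> J \<Longrightarrow> j' \<in> J \<Longrightarrow> j \<sqsubset> j' \<Longrightarrow> R (\<delta> j, t j, h j) (\<delta> j', t j', h j')"
    for J :: "'k set" and \<delta> t h
  proof (rule chain_limit)
    fix j j' x assume "j \<in> J" "j' \<in> J" "x \<sqsubset> \<delta> j" "x \<sqsubset> \<delta> j'"
    then show "t j x = t j' x"
      using R[of j j'] R[of j' j] O.less_linear[of j j'] unfolding R_def agree_def by auto
  qed
  obtain t0 where "t0 \<in> C" using dense_C by blast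
  have R_trans: "R (d1, t1, h1) (d3, t3, h3)"
    if 12: "R (d1, t1, h1) (d2, t2, h2)" and 23: "R (d2, t2, h2) (d3, t3, h3)" for d1 t1 h1 d2 t2 h2 d3 t3 h3
  proof -
    have "agree d1 t1 t3" using 12 23 agree_trans[of d1 t1 t2 t3] agree_mono[of d2 t2 t3 d1] unfolding R_def by simp
    moreover have "d1 \<sqsubseteq> d3" using 12 23 O.order.trans[of d1 d2 d3] unfolding R_def by simp
    moreover have "e False r \<gamma> \<in> h1 \<or> d1 \<sqsubseteq> r" if "e False r \<gamma> \<in> h3" for r \<gamma>
    proof -
      have "e False r \<gamma> \<in> h2 \<or> d2 \<sqsubseteq> r" using 23 that unfolding R_def by simp
      then show ?thesis using 12 O.order.trans[of d1 d2 r] unfolding R_def by auto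
    qed
    ultimately show ?thesis using 12 23 unfolding R_def by auto
  qed
  obtain p where p: "\<And>i. p i \<in> P" "\<And>i. Q i (p i)" "\<And>i j. j \<sqsubset> i \<Longrightarrow> R (p j) (p i)"
  proof (rule generic_chain[of R P Q])
    show "R a c" if "R a b" "R b c" for a b c
      using R_trans that by (cases a, cases b, cases c) blast
    show "(t0', t0, {}) \<in> P" for t0' using \<open>t0 \<in> C\<close> good_empty unfolding P_def by simp
    fix i and p :: "'k \<Rightarrow> 'k \<times> ('k \<Rightarrow> bool) \<times> 'k set"
    assume P': "\<And>j. j \<sqsubset> i \<Longrightarrow> p j \<in> P" and R': "\<And>j j'. j \<sqsubset> j' \<Longrightarrow> j' \<sqsubset> i \<Longrightarrow> R (p j) (p j')"
    define \<delta> t h where "\<delta> j = fst (p j)" and "t j = fst (snd (p j))" and "h j = snd (snd (p j))" for j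
    have pj: "p j = (\<delta> j, t j, h j)" for j by (simp add: \<delta>_def t_def h_def)
    have P: "(\<delta> j, t j, h j) \<in> P" if "j \<in> underS \<kappa> i" for j using P' that unfolding pj by blast
    have R: "R (\<delta> j, t j, h j) (\<delta> j', t j', h j')" if "j \<in> underS \<kappa> i" "j' \<in> underS \<kappa> i" "j \<sqsubset> j'" for j j'
      using R' that unfolding pj by blast
    obtain t1 where t1: "\<And>j. j \<sqsubset> i \<Longrightarrow> agree (\<delta> j) (t j) t1" using agr[of "underS \<kappa> i" \<delta> t h] R by blast
    obtain d where d: "\<And>j. j \<sqsubset> i \<Longrightarrow> \<delta> j \<sqsubset> d"
      using bdd_image[OF bdd_underS(1), of \<delta> i] unfolding bdd_def by blast
    \<comment> \<open>The limit of the earlier points may lie outside \<open>C\<close>; density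
      replaces it by a point of \<open>C\<close> with the same initial segment.\<close>
    obtain t2 where t2: "t2 \<in> C" "agree d t1 t2" using dense_C by blast
    have "(d, t2, \<Union>j\<in>underS \<kappa> i. h j) \<in> P"
    proof -
      have "(\<Union>j\<in>underS \<kappa> i. h j) \<subseteq> underS \<kappa> d" using P d O.less_trans unfolding P_def by blast
      then show ?thesis using good_UN[of "underS \<kappa> i" \<delta> t h] P R t2(1) unfolding P_def by simp
    qed
    moreover have "R (p j) (d, t2, \<Union>j\<in>underS \<kappa> i. h j)" if j: "j \<sqsubset> i" for j
    proof -
      have "agree (\<delta> j) (t j) t2" using t1[OF j] t2(2) agree_mono_lt[OF _ d[OF j]] agree_trans by blast
      moreover have "e False r \<gamma> \<in> h j \<or> \<delta> j \<sqsubseteq> r" if j': "j' \<sqsubset> i" and x: "e False r \<gamma> \<in> h j'" for r \<gamma> j'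
        using R[OF j j'] R[OF j' j] x O.less_linear[of j j'] unfolding R_def by auto
      ultimately show ?thesis using d[OF j] O.less_imp_le j unfolding R_def pj by auto
    qed
    ultimately show "\<exists>q\<in>P. \<forall>j. j \<sqsubset> i \<longrightarrow> R (p j) q" by blast
  next
    fix i and q :: "'k \<times> ('k \<Rightarrow> bool) \<times> 'k set" assume "q \<in> P"
    obtain \<delta> t h where q: "q = (\<delta>, t, h)" by (cases q)
    have t: "t \<in> C" and h: "good X h" "h \<subseteq> underS \<kappa> \<delta>" using \<open>q \<in> P\<close> unfolding P_def q by auto
    have bh: "bdd h" using bdd_subset[OF bdd_underS(1) h(2)] .
    obtain t' g where t': "t' \<in> C" "agree \<delta> t t'" and g: "good X g" "bdd g" "\<And>r \<gamma>. e False r \<gamma> \<in> g \<Longrightarrow> \<delta> \<sqsubseteq> r"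
      and nl: "(f t', f (flip g (flip h t'))) \<notin> locrel Y i"
      using not_settled_step[OF ns t bh] by blast
    \<comment> \<open>New changes lie in rows from \<open>\<delta>\<close> on, old ones have codes
      below \<open>\<delta>\<close>. Disjointness makes the two successive flips a flip along the
      union.\<close>
    have "g \<inter> h = {}"
    proof (rule ccontr)
      assume "g \<inter> h \<noteq> {}"
      then obtain x where x: "x \<in> g" "x \<in> h" by blast
      then obtain r \<gamma> where "x = e False r \<gamma>" using g(1) unfolding good_def by blast
      then have r: "e False r \<gamma> \<in> g" "e False r \<gamma> \<in> h" using x by simp_all
      then have "e False r \<gamma> \<sqsubset> r" using g(3)[OF r(1)] h(2) O.less_le_trans by blast
      then show False using e_ge_row O.leD by blast
    qed
    then have h': "good X (g \<union> h)" "sym_diff g h = g \<union> h" using good_disjoint_Un g(1) h(1) by auto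
    define s where "s = flip (g \<union> h) t'"
    have s: "s \<in> C" unfolding s_def using C_flip bdd_Un g(2) bh t'(1) by blast
    have "(f t', f s) \<notin> locrel Y i" using nl unfolding flip_flip s_def h'(2) .
    then obtain d1 where d1: "\<And>t'' s'. t'' \<in> C \<Longrightarrow> s' \<in> C \<Longrightarrow> agree d1 t' t'' \<Longrightarrow> agree d1 s s' \<Longrightarrow> (f t'', f s') \<notin> locrel Y i"
      using decided[OF t'(1) s] by blast
    have "t' \<in> D i" "s \<in> D i" using t'(1) s unfolding C_eq by auto
    then obtain d2 d3 where d23: "\<And>\<xi>. agree d2 t' \<xi> \<Longrightarrow> \<xi> \<in> D i" "\<And>\<xi>. agree d3 s \<xi> \<Longrightarrow> \<xi> \<in> D i"
      using D_opn[of i] unfolding opn_iff by blast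
    have "bdd (insert d1 (insert d2 (insert d3 (insert i (insert \<delta> (g \<union> h))))))"
      by (intro bdd_insert bdd_Un g(2) bh)
    then obtain d where d: "d1 \<sqsubset> d" "d2 \<sqsubset> d" "d3 \<sqsubset> d" "i \<sqsubset> d" "\<delta> \<sqsubset> d" "g \<union> h \<subseteq> underS \<kappa> d"
      unfolding bdd_def by blast
    have "(d, t', g \<union> h) \<in> P" using t'(1) h'(1) d(6) unfolding P_def by simp
    moreover have "R q (d, t', g \<union> h)" using t'(2) d(5) g(3) O.less_imp_le unfolding R_def q by auto
    moreover have "Q i (d, t', g \<union> h)"
      using d(4) d1 d23 agree_mono_lt[OF _ d(1)] agree_mono_lt[OF _ d(2)] agree_mono_lt[OF _ d(3)]
      unfolding Q_def s_def by simp
    ultimately show "\<exists>q'\<in>P. R q q' \<and> Q i q'" by blast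
  qed blast
  define \<delta> t h where "\<delta> j = fst (p j)" and "t j = fst (snd (p j))" and "h j = snd (snd (p j))" for j
  have pj: "p j = (\<delta> j, t j, h j)" for j by (simp add: \<delta>_def t_def h_def)
  have P: "(\<delta> j, t j, h j) \<in> P" and Q: "Q j (\<delta> j, t j, h j)" for j using p unfolding pj by blast+
  have R: "R (\<delta> j, t j, h j) (\<delta> j', t j', h j')" if "j \<sqsubset> j'" for j j' using p(3)[OF that] unfolding pj .
  obtain t1 where t1: "\<And>j. agree (\<delta> j) (t j) t1" using agr[of UNIV \<delta> t h] R by blast
  define h1 where "h1 = (\<Union>j. h j)"
  have good: "good X h1" unfolding h1_def using good_UN[of UNIV \<delta> t h] P R by blast
  \<comment> \<open>Changes made after stage \<open>j\<close> lie in rows, and therefore have codes,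
    from \<open>\<delta> j\<close> on; below \<open>\<delta> j\<close> the total change is
    \<open>h j\<close>.\<close>
  have "agree (\<delta> j) (flip (h j) (t j)) (flip h1 t1)" for j
  proof -
    have "x \<in> h j" if xj: "x \<in> h j'" "x \<sqsubset> \<delta> j" for x j'
    proof -
      have "good X (h j')" using P[of j'] unfolding P_def by simp
      then obtain r \<gamma> where x: "x = e False r \<gamma>" using xj(1) unfolding good_def by blast
      have "r \<sqsubset> \<delta> j" using xj(2) e_ge_row O.le_less_trans unfolding x by blast
      then have "\<not> \<delta> j \<sqsubseteq> r" using O.leD by blast
      then show ?thesis
        using R[of j j'] R[of j' j] xj(1) O.less_linear[of j j'] unfolding R_def x by auto
    qed
    then have "x \<in> h j \<longleftrightarrow> x \<in> h1" if "x \<sqsubset> \<delta> j" for x using that unfolding h1_def by blast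
    then show ?thesis using t1[of j] unfolding agree_def flip_def by simp
  qed
  then have t1': "t1 \<in> C" "flip h1 t1 \<in> C" using Q t1 unfolding Q_def C_eq by auto
  have "(f t1, f (flip h1 t1)) \<notin> locrel Y j" for j
    using Q[of j] t1 t1' \<open>agree (\<delta> j) (flip (h j) (t j)) (flip h1 t1)\<close> unfolding Q_def by blast
  then have "(f t1, f (flip h1 t1)) \<notin> erel Y" unfolding erel_def by blast
  then show False using good_erel[OF good] f_red by blast
qed

text \<open>Whole rows of the images are compared, not only tails, so that the equality survives the
  passage to an unbounded change in \<open>absurd\<close>.\<close>

definition locked :: "'k \<Rightarrow> 'k \<Rightarrow> 'k \<Rightarrow> ('k \<Rightarrow> bool) \<Rightarrow> bool" where
  "locked r \<rho> \<delta> t \<longleftrightarrow> (\<forall>s\<in>C. agree \<delta> t s \<longrightarrow> (\<forall>h. good X h \<longrightarrow> bdd h \<longrightarrow>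
     (\<forall>x\<in>h. \<exists>\<gamma>. x = e False r \<gamma> \<and> \<delta> \<sqsubseteq> \<gamma>) \<longrightarrow> tpart (f s) \<rho> = tpart (f (flip h s)) \<rho>))"

text \<open>Either truth value of the difference can be realised late in row \<open>\<rho>\<close>.
  If only \<open>\<not> v\<close> occurred, then, with \<open>u = flip h s\<close>, both
  \<open>f u\<close> and \<open>f (flip g u)\<close> would differ from \<open>f s\<close> in the
  same way at \<open>\<gamma>\<close>. A change \<open>g\<close> violating \<open>locked\<close>
  near \<open>flip h s0\<close> alters that entry.\<close>

lemma unlocked_step:
  fixes v :: bool
  assumes nl: "\<And>\<delta> t. t \<in> C \<Longrightarrow> agree \<delta>1 t1 t \<Longrightarrow> \<delta>1 \<sqsubseteq> \<delta> \<Longrightarrow> \<not> locked r \<rho> \<delta> t"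
    and s0: "s0 \<in> C" "agree \<delta>1 t1 s0" and \<delta>: "\<delta>1 \<sqsubseteq> \<delta>"
    and h: "bdd h" "\<forall>x\<in>h. \<exists>\<gamma>. x = e False r \<gamma> \<and> \<delta>1 \<sqsubseteq> \<gamma>"
  shows "\<exists>s\<in>C. agree \<delta> s0 s \<and> (\<exists>g. good X g \<and> bdd g \<and> (\<forall>x\<in>g. \<exists>\<gamma>. x = e False r \<gamma> \<and> \<delta> \<sqsubseteq> \<gamma>) \<and>
    (\<exists>\<gamma>. \<delta> \<sqsubseteq> \<gamma> \<and> (tpart (f s) \<rho> \<gamma> \<noteq> tpart (f (flip g (flip h s))) \<rho> \<gamma>) = v))"
proof (rule ccontr)
  assume "\<not> ?thesis"
  then have const: "(tpart (f s) \<rho> \<gamma> \<noteq> tpart (f (flip g (flip h s))) \<rho> \<gamma>) = (\<not> v)"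
    if "s \<in> C" "agree \<delta> s0 s" "good X g" "bdd g" "\<forall>x\<in>g. \<exists>\<gamma>. x = e False r \<gamma> \<and> \<delta> \<sqsubseteq> \<gamma>" "\<delta> \<sqsubseteq> \<gamma>" for s g \<gamma>
    using that by blast
  define u0 where "u0 = flip h s0"
  have u0: "u0 \<in> C" unfolding u0_def using C_flip h(1) s0(1) by blast
  have "agree \<delta>1 s0 u0" unfolding u0_def using h(2) by (rule agree_flip_cols)
  then have u01: "agree \<delta>1 t1 u0" using s0(2) agree_trans by blast
  obtain \<alpha> where \<alpha>: "\<And>\<eta> \<xi> \<gamma>. agree \<alpha> \<eta> \<xi> \<Longrightarrow> \<gamma> \<sqsubset> \<delta> \<Longrightarrow> tpart \<eta> \<rho> \<gamma> = tpart \<xi> \<rho> \<gamma>"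
    using agree_tpart[of \<delta> \<rho>] by blast
  obtain d where d: "\<And>\<xi>. \<xi> \<in> C \<Longrightarrow> agree d u0 \<xi> \<Longrightarrow> agree \<alpha> (f u0) (f \<xi>)" using f_cont_bdd[OF u0] by blast
  \<comment> \<open>Beyond \<open>d\<close> the image row is fixed below \<open>\<delta>\<close>, so
    the entry altered by a change of columns from \<open>d'\<close> on has index at least
    \<open>\<delta>\<close>.\<close>
  obtain d' where d': "d \<sqsubset> d'" "\<delta> \<sqsubset> d'" using ex_ge2 by blast
  have "\<not> locked r \<rho> d' u0" using nl[OF u0 u01, of d'] \<delta> d'(2) O.less_imp_le O.le_less_trans by blast
  then obtain u g where u: "u \<in> C" "agree d' u0 u" and g: "good X g" "bdd g"
      "\<forall>x\<in>g. \<exists>\<gamma>. x = e False r \<gamma> \<and> d' \<sqsubseteq> \<gamma>" "tpart (f u) \<rho> \<noteq> tpart (f (flip g u)) \<rho>"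
    unfolding locked_def by blast
  obtain \<gamma> where \<gamma>: "tpart (f u) \<rho> \<gamma> \<noteq> tpart (f (flip g u)) \<rho> \<gamma>" using g(4) by blast
  have gu: "flip g u \<in> C" using C_flip g(2) u(1) by blast
  have "agree d' u (flip g u)" using g(3) by (rule agree_flip_cols)
  then have "agree d u0 u" "agree d u0 (flip g u)" using u(2) agree_trans agree_mono_lt[OF _ d'(1)] by blast+
  then have "agree \<alpha> (f u0) (f u)" "agree \<alpha> (f u0) (f (flip g u))" using d u(1) gu by blast+
  then have "\<delta> \<sqsubseteq> \<gamma>" using \<alpha>[of "f u0" "f u" \<gamma>] \<alpha>[of "f u0" "f (flip g u)" \<gamma>] \<gamma> O.not_le by blast
  define s where "s = flip h u"
  have s: "s \<in> C" "flip h s = u" unfolding s_def using C_flip h(1) u(1) by auto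
  have "agree \<delta> (flip h u0) s" unfolding s_def agree_flip using u(2) agree_mono_lt d'(2) by blast
  then have ag: "agree \<delta> s0 s" unfolding u0_def by simp
  have g\<delta>: "\<forall>x\<in>g. \<exists>\<gamma>. x = e False r \<gamma> \<and> \<delta> \<sqsubseteq> \<gamma>" using g(3) d'(2) O.less_imp_le O.order.trans by meson
  have "bdd {}" unfolding bdd_def by simp
  then show False
    using const[OF s(1) ag g(1,2) g\<delta> \<open>\<delta> \<sqsubseteq> \<gamma>\<close>] const[OF s(1) ag good_empty _ _ \<open>\<delta> \<sqsubseteq> \<gamma>\<close>] \<gamma>
    unfolding s(2) by auto
qed

text \<open>Otherwise \<open>unlocked_step\<close> produces, in \<omega> steps, images that differ
  and agree alternately and cofinally below a point \<open>a\<close> of \<open>S i\<close>. Since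
  \<open>i\<close> is not in \<open>Y\<close> and \<open>\<beta> \<sqsubseteq> i\<close>, this
  violates \<open>locrel Y \<beta>\<close>. Since \<open>i\<close> is in \<open>X\<close>, the total
  change is nevertheless admissible, contrary to \<open>settled\<close>.\<close>

lemma ex_locked:
  assumes st: "settled \<delta>0 t0 \<beta>" and i: "i \<in> X" "i \<notin> Y" "\<beta> \<sqsubseteq> i"
    and t1: "t1 \<in> C" "agree \<delta>0 t0 t1" and \<delta>01: "\<delta>0 \<sqsubseteq> \<delta>1"
  shows "\<exists>\<delta> t. t \<in> C \<and> agree \<delta>1 t1 t \<and> locked \<delta>0 \<rho> \<delta> t"
proof (rule ccontr)
  assume "\<not> ?thesis"
  then have nl: "\<not> locked \<delta>0 \<rho> \<delta> t" if "t \<in> C" "agree \<delta>1 t1 t" for \<delta> t using that by blast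
  \<comment> \<open>Conditions are given by bounded sets instead of total functions, so that
    \<kappa> many codes suffice for the states.\<close>
  define ch where "ch A = (\<lambda>x. x \<in> A)" for A :: "'k set"
  \<comment> \<open>The state \<open>(\<delta>, A, h)\<close> stands for the pair of conditions \<open>A\<close> and \<open>flip h A\<close> of length \<open>\<delta>\<close>.\<close>
  define Q where "Q = {(\<delta>, A, h). A \<subseteq> underS \<kappa> \<delta> \<and> good X h \<and> h \<subseteq> underS \<kappa> \<delta> \<and>
    (\<forall>x\<in>h. \<exists>\<gamma>. x = e False \<delta>0 \<gamma> \<and> \<delta>1 \<sqsubseteq> \<gamma>) \<and> agree \<delta>1 t1 (ch A) \<and> \<delta>1 \<sqsubseteq> \<delta>}"
  \<comment> \<open>Even steps force a difference of the images at a new entry, odd steps force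
    agreement.\<close>
  define N where "N n = (\<lambda>(\<delta>, A, h) (\<delta>', A', h'). agree \<delta> (ch A) (ch A') \<and> h \<subseteq> h' \<and> \<delta> \<sqsubseteq> \<delta>' \<and>
    (\<forall>x\<in>h' - h. \<exists>\<gamma>. x = e False \<delta>0 \<gamma> \<and> \<delta> \<sqsubseteq> \<gamma>) \<and>
    (\<exists>\<gamma>. \<delta> \<sqsubseteq> \<gamma> \<and> \<gamma> \<sqsubset> \<delta>' \<and> (\<forall>s\<in>C. \<forall>s'\<in>C. agree \<delta>' (ch A') s \<longrightarrow> agree \<delta>' (ch A') (flip h' s') \<longrightarrow>
       (tpart (f s) \<rho> \<gamma> \<noteq> tpart (f s') \<rho> \<gamma>) = even n)))" for n :: nat
  have step: "\<exists>q'\<in>Q. N n q q' \<and> \<zeta> \<sqsubset> fst q'" if "q \<in> Q" for n q \<zeta>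
  proof -
    obtain \<delta> A h where q: "q = (\<delta>, A, h)" by (cases q)
    have A: "A \<subseteq> underS \<kappa> \<delta>" and h: "good X h" "h \<subseteq> underS \<kappa> \<delta>" "\<forall>x\<in>h. \<exists>\<gamma>. x = e False \<delta>0 \<gamma> \<and> \<delta>1 \<sqsubseteq> \<gamma>"
      and ag: "agree \<delta>1 t1 (ch A)" and \<delta>: "\<delta>1 \<sqsubseteq> \<delta>" using that unfolding Q_def q by auto
    have bh: "bdd h" using bdd_subset[OF bdd_underS(1) h(2)] .
    obtain s0 where s0: "s0 \<in> C" "agree \<delta> (ch A) s0" using dense_C by blast
    have "agree \<delta>1 t1 s0" using agree_trans[OF ag agree_mono[OF s0(2) \<delta>]] .
    then obtain s g \<gamma> where s: "s \<in> C" "agree \<delta> s0 s" and g: "good X g" "bdd g"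
        "\<forall>x\<in>g. \<exists>\<gamma>. x = e False \<delta>0 \<gamma> \<and> \<delta> \<sqsubseteq> \<gamma>"
      and \<gamma>: "\<delta> \<sqsubseteq> \<gamma>" "(tpart (f s) \<rho> \<gamma> \<noteq> tpart (f (flip g (flip h s))) \<rho> \<gamma>) = even n"
      using unlocked_step[of \<delta>1 t1 \<delta>0 \<rho> s0 \<delta> h "even n"] nl s0(1) \<delta> bh h(3) by blast
    have "g \<inter> h = {}"
    proof (rule ccontr)
      assume "g \<inter> h \<noteq> {}"
      then obtain x where x: "x \<in> g" "x \<in> h" by blast
      then obtain \<gamma>' where "x = e False \<delta>0 \<gamma>'" "\<delta> \<sqsubseteq> \<gamma>'" using g(3) by blast
      then have "\<delta> \<sqsubseteq> x" using e_ge_col O.order.trans by blast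
      then show False using x(2) h(2) O.leD by blast
    qed
    then have h': "good X (g \<union> h)" "sym_diff g h = g \<union> h" using good_disjoint_Un g(1) h(1) by auto
    define s' where "s' = flip (g \<union> h) s"
    have s': "s' \<in> C" unfolding s'_def using C_flip bdd_Un g(2) bh s(1) by blast
    have val: "(tpart (f s) \<rho> \<gamma> \<noteq> tpart (f s') \<rho> \<gamma>) = even n" using \<gamma>(2) unfolding flip_flip h'(2) s'_def .
    obtain d1 where d1: "\<And>\<xi>. \<xi> \<in> C \<Longrightarrow> agree d1 s \<xi> \<Longrightarrow> tpart (f \<xi>) \<rho> \<gamma> = tpart (f s) \<rho> \<gamma>"
      using f_cont[OF s(1), of "e False \<rho> \<gamma>"] unfolding tpart_def by blast
    obtain d2 where d2: "\<And>\<xi>. \<xi> \<in> C \<Longrightarrow> agree d2 s' \<xi> \<Longrightarrow> tpart (f \<xi>) \<rho> \<gamma> = tpart (f s') \<rho> \<gamma>"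
      using f_cont[OF s', of "e False \<rho> \<gamma>"] unfolding tpart_def by blast
    have "bdd (insert d1 (insert d2 (insert \<zeta> (insert \<gamma> (g \<union> h)))))"
      by (intro bdd_insert bdd_Un g(2) bh)
    then obtain d where d: "d1 \<sqsubset> d" "d2 \<sqsubset> d" "\<zeta> \<sqsubset> d" "\<gamma> \<sqsubset> d" "g \<union> h \<subseteq> underS \<kappa> d"
      unfolding bdd_def by blast
    have \<delta>d: "\<delta> \<sqsubseteq> d" using \<gamma>(1) d(4) O.less_imp_le O.order.trans by blast
    define A' where "A' = {x. x \<sqsubset> d \<and> s x}"
    have A's: "agree d s (ch A')" unfolding agree_def ch_def A'_def by blast
    have AA': "agree \<delta> (ch A) (ch A')" using s0(2) s(2) agree_mono[OF A's \<delta>d] agree_trans by blast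
    have "A' \<subseteq> underS \<kappa> d" unfolding A'_def by blast
    moreover have "agree \<delta>1 t1 (ch A')" using agree_trans[OF ag agree_mono[OF AA' \<delta>]] .
    moreover have "\<forall>x\<in>g \<union> h. \<exists>\<gamma>. x = e False \<delta>0 \<gamma> \<and> \<delta>1 \<sqsubseteq> \<gamma>"
    proof
      fix x assume "x \<in> g \<union> h"
      then show "\<exists>\<gamma>. x = e False \<delta>0 \<gamma> \<and> \<delta>1 \<sqsubseteq> \<gamma>"
      proof
        assume "x \<in> g"
        then obtain \<gamma>' where "x = e False \<delta>0 \<gamma>'" "\<delta> \<sqsubseteq> \<gamma>'" using g(3) by blast
        then show ?thesis using O.order.trans[OF \<delta>] by blast
      qed (use h(3) in blast)
    qed
    ultimately have "(d, A', g \<union> h) \<in> Q"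
      using h'(1) d(5) O.order.trans[OF \<delta> \<delta>d] unfolding Q_def by simp
    moreover have "(tpart (f u) \<rho> \<gamma> \<noteq> tpart (f u') \<rho> \<gamma>) = even n"
      if u: "u \<in> C" "u' \<in> C" "agree d (ch A') u" "agree d (ch A') (flip (g \<union> h) u')" for u u'
    proof -
      have "agree d s u" using agree_trans[OF A's u(3)] .
      moreover have "agree d s (flip (g \<union> h) u')" using agree_trans[OF A's u(4)] .
      then have "agree d s' u'" using agree_flip[of d "g \<union> h" s "flip (g \<union> h) u'"] unfolding s'_def by simp
      ultimately show ?thesis using val d1[OF u(1)] d2[OF u(2)] agree_mono_lt d(1,2) by simp
    qed
    then have "N n q (d, A', g \<union> h)"
      using AA' \<delta>d g(3) \<gamma>(1) d(4) unfolding N_def q by auto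
    ultimately show ?thesis using d(3) by (intro bexI[of _ "(d, A', g \<union> h)"]) auto
  qed
  obtain en :: "'k \<Rightarrow> 'k \<times> 'k set \<times> 'k set" where en: "\<And>\<delta> A h. bdd A \<Longrightarrow> bdd h \<Longrightarrow> (\<delta>, A, h) \<in> range en"
    using ex_enum_states by blast
  have "Q \<subseteq> range en"
  proof
    fix q assume "q \<in> Q"
    moreover obtain \<delta> A h where q: "q = (\<delta>, A, h)" by (cases q)
    ultimately have "A \<subseteq> underS \<kappa> \<delta>" "h \<subseteq> underS \<kappa> \<delta>" unfolding Q_def by auto
    then show "q \<in> range en" unfolding q using en bdd_subset[OF bdd_underS(1)] by blast
  qed
  moreover have "(\<delta>1, {x. x \<sqsubset> \<delta>1 \<and> t1 x}, {}) \<in> Q"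
    unfolding Q_def using good_empty by (auto simp: agree_def ch_def)
  ultimately obtain a q where a: "a \<in> S i" and q: "\<And>n. q n \<in> Q" "\<And>n. N n (q n) (q (Suc n))"
      "\<And>n. fst (q n) \<sqsubset> a" "\<And>b. b \<sqsubset> a \<Longrightarrow> \<exists>n. b \<sqsubset> fst (q n)"
    using omega_stationary_chain[OF S_stat[of i], of Q en _ N fst] step by (metis (no_types, lifting))
  define \<delta> A h where "\<delta> n = fst (q n)" and "A n = fst (snd (q n))" and "h n = snd (snd (q n))" for n
  have qn: "q n = (\<delta> n, A n, h n)" for n by (simp add: \<delta>_def A_def h_def)
  have \<delta>a: "\<delta> n \<sqsubset> a" for n using q(3) unfolding \<delta>_def .
  have cof: "\<exists>n. b \<sqsubset> \<delta> n" if "b \<sqsubset> a" for b using q(4)[OF that] unfolding \<delta>_def .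
  have Qn: "(\<delta> n, A n, h n) \<in> Q" and Nn: "N n (\<delta> n, A n, h n) (\<delta> (Suc n), A (Suc n), h (Suc n))" for n
    using q(1,2) unfolding qn by blast+
  have mono: "\<delta> n \<sqsubseteq> \<delta> m \<and> agree (\<delta> n) (ch (A n)) (ch (A m)) \<and> h n \<subseteq> h m \<and>
      (\<forall>x\<in>h m - h n. \<exists>\<gamma>. x = e False \<delta>0 \<gamma> \<and> \<delta> n \<sqsubseteq> \<gamma>)" if "n \<le> m" for n m
    using that
  proof (induction m rule: dec_induct)
    case base
    then show ?case by simp
  next
    case (step m)
    have 1: "\<delta> n \<sqsubseteq> \<delta> m" "agree (\<delta> n) (ch (A n)) (ch (A m))" "h n \<subseteq> h m"
      "\<forall>x\<in>h m - h n. \<exists>\<gamma>. x = e False \<delta>0 \<gamma> \<and> \<delta> n \<sqsubseteq> \<gamma>" using step.IH by auto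
    have 2: "\<delta> m \<sqsubseteq> \<delta> (Suc m)" "agree (\<delta> m) (ch (A m)) (ch (A (Suc m)))" "h m \<subseteq> h (Suc m)"
      "\<forall>x\<in>h (Suc m) - h m. \<exists>\<gamma>. x = e False \<delta>0 \<gamma> \<and> \<delta> m \<sqsubseteq> \<gamma>" using Nn[of m] unfolding N_def by auto
    have "\<exists>\<gamma>. x = e False \<delta>0 \<gamma> \<and> \<delta> n \<sqsubseteq> \<gamma>" if x: "x \<in> h (Suc m) - h n" for x
    proof (cases "x \<in> h m")
      case False
      then obtain \<gamma> where "x = e False \<delta>0 \<gamma>" "\<delta> m \<sqsubseteq> \<gamma>" using 2(4) x by blast
      then show ?thesis using O.order.trans[OF 1(1)] by blast
    qed (use 1(4) x in blast)
    moreover have "\<delta> n \<sqsubseteq> \<delta> (Suc m)" using O.order.trans[OF 1(1) 2(1)] .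
    moreover have "agree (\<delta> n) (ch (A n)) (ch (A (Suc m)))"
      using agree_trans[OF 1(2) agree_mono[OF 2(2) 1(1)]] .
    ultimately show ?case using 1(3) 2(3) by blast
  qed
  have "\<exists>\<xi>. \<forall>n\<in>UNIV. agree (\<delta> n) (ch (A n)) \<xi>"
  proof (rule chain_limit)
    fix n m x assume "x \<sqsubset> \<delta> n" "x \<sqsubset> \<delta> m"
    then show "ch (A n) x = ch (A m) x"
      using mono[of n m] mono[of m n] nat_le_linear[of n m] unfolding agree_def by metis
  qed
  then obtain \<xi> where \<xi>: "\<And>n. agree (\<delta> n) (ch (A n)) \<xi>" by blast
  obtain t where t: "t \<in> C" "agree a \<xi> t" using dense_C by blast
  have At: "agree (\<delta> n) (ch (A n)) t" for n using agree_trans[OF \<xi> agree_mono_lt[OF t(2) \<delta>a]] .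
  define h' where "h' = (\<Union>n. h n)"
  have h'a: "h' \<subseteq> underS \<kappa> a" unfolding h'_def using Qn \<delta>a O.less_trans unfolding Q_def by blast
  have bh': "bdd h'" using bdd_subset[OF bdd_underS(1) h'a] .
  have new: "\<exists>\<gamma>. x = e False \<delta>0 \<gamma> \<and> \<delta> n \<sqsubseteq> \<gamma>" if "x \<in> h'" "x \<notin> h n" for x n
  proof -
    obtain m where m: "x \<in> h m" using \<open>x \<in> h'\<close> unfolding h'_def by blast
    then have "n \<le> m" using mono[of m n] that(2) nat_le_linear[of n m] by blast
    then show ?thesis using mono[of n m] m that(2) by blast
  qed
  have row0: "\<exists>\<gamma>. x = e False \<delta>0 \<gamma>" if x: "x \<in> h'" for x
  proof -
    obtain m where "x \<in> h m" using x unfolding h'_def by blast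
    then show ?thesis using Qn[of m] unfolding Q_def by blast
  qed
  define s where "s = flip h' t"
  have s: "s \<in> C" unfolding s_def using C_flip bh' t(1) by blast
  have As: "agree (\<delta> n) (ch (A n)) (flip (h n) s)" for n
  proof -
    have "x \<in> h' \<longleftrightarrow> x \<in> h n" if x: "x \<sqsubset> \<delta> n" for x
    proof
      assume x': "x \<in> h'"
      show "x \<in> h n"
      proof (rule ccontr)
        assume "x \<notin> h n"
        then obtain \<gamma> where "x = e False \<delta>0 \<gamma>" "\<delta> n \<sqsubseteq> \<gamma>" using new x' by blast
        then have "\<delta> n \<sqsubseteq> x" using e_ge_col O.order.trans by blast
        then show False using x O.leD by blast
      qed
    qed (auto simp: h'_def)
    then show ?thesis using At[of n] unfolding s_def agree_def flip_def by auto
  qed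
  have alt: "\<exists>\<gamma>. \<delta> n \<sqsubseteq> \<gamma> \<and> \<gamma> \<sqsubset> a \<and> (tpart (f t) \<rho> \<gamma> \<noteq> tpart (f s) \<rho> \<gamma>) = even n" for n
  proof -
    obtain \<gamma> where "\<delta> n \<sqsubseteq> \<gamma>" "\<gamma> \<sqsubset> \<delta> (Suc n)"
      "\<And>s s'. s \<in> C \<Longrightarrow> s' \<in> C \<Longrightarrow> agree (\<delta> (Suc n)) (ch (A (Suc n))) s \<Longrightarrow>
         agree (\<delta> (Suc n)) (ch (A (Suc n))) (flip (h (Suc n)) s') \<Longrightarrow>
         (tpart (f s) \<rho> \<gamma> \<noteq> tpart (f s') \<rho> \<gamma>) = even n"
      using Nn[of n] unfolding N_def by blast
    moreover have "\<gamma> \<sqsubset> a" using O.less_trans[OF \<open>\<gamma> \<sqsubset> \<delta> (Suc n)\<close> \<delta>a] .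
    ultimately show ?thesis using t(1) s At[of "Suc n"] As[of "Suc n"] by blast
  qed
  have "\<not> econst a (tpart (f t) \<rho>) (tpart (f s) \<rho>)"
  proof
    assume "econst a (tpart (f t) \<rho>) (tpart (f s) \<rho>)"
    then obtain b v where b: "b \<sqsubset> a" "\<And>\<gamma>. b \<sqsubseteq> \<gamma> \<Longrightarrow> \<gamma> \<sqsubset> a \<Longrightarrow> (tpart (f t) \<rho> \<gamma> \<noteq> tpart (f s) \<rho> \<gamma>) = v"
      using \<delta>a[of 0] unfolding econst_def by blast
    obtain n where n: "b \<sqsubset> \<delta> n" using cof[OF b(1)] by blast
    have "even m = v" if "n \<le> m" for m
    proof -
      obtain \<gamma> where \<gamma>: "\<delta> m \<sqsubseteq> \<gamma>" "\<gamma> \<sqsubset> a" "(tpart (f t) \<rho> \<gamma> \<noteq> tpart (f s) \<rho> \<gamma>) = even m" using alt by blast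
      have "\<delta> n \<sqsubseteq> \<delta> m" using mono[OF that] by blast
      then have "b \<sqsubseteq> \<gamma>" using n \<gamma>(1) O.less_imp_le O.order.trans by blast
      then show ?thesis using b(2)[OF _ \<gamma>(2)] \<gamma>(3) by blast
    qed
    from this[of n] this[of "Suc n"] show False by simp
  qed
  then have "(f t, f s) \<notin> locrel Y \<beta>" using i(2,3) a unfolding locrel_def by blast
  moreover have "(f t, f s) \<in> locrel Y \<beta>"
  proof -
    have "good_row X (row h' \<delta>0)" unfolding good_row_def
    proof (intro conjI allI impI)
      show "bdd (row h' \<delta>0)" unfolding bdd_def row_def
        using h'a O.le_less_trans[OF e_ge_col] by blast
      fix m c assume m: "m \<notin> X" and c: "c \<in> S m"
      \<comment> \<open>The change may oscillate only at \<open>a\<close>, which belongs to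
        \<open>S i\<close> and to no \<open>S m\<close> with \<open>m\<close> outside
        \<open>X\<close>. Below \<open>a\<close> a single stage determines the change, and from
        \<open>a\<close> on it is empty.\<close>
      have "c \<noteq> a" using S_disj[OF a, of m] m i(1) c by blast
      then consider "c \<sqsubset> a" | "a \<sqsubset> c" using O.less_linear by blast
      then show "econst c (\<lambda>\<gamma>. \<gamma> \<in> row h' \<delta>0) (\<lambda>_. False)"
      proof cases
        case 1
        then obtain n where n: "c \<sqsubset> \<delta> n" using cof by blast
        have "\<gamma> \<in> row h' \<delta>0 \<longleftrightarrow> \<gamma> \<in> row (h n) \<delta>0" if \<gamma>: "\<gamma> \<sqsubset> c" for \<gamma>
        proof -
          have "\<not> \<delta> n \<sqsubseteq> \<gamma>" using \<gamma> n O.less_trans O.leD by blast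
          then show ?thesis using new[of "e False \<delta>0 \<gamma>" n] unfolding row_def h'_def by auto
        qed
        moreover have "econst c (\<lambda>\<gamma>. \<gamma> \<in> row (h n) \<delta>0) (\<lambda>_. False)"
          using Qn[of n] m c unfolding Q_def good_def good_row_def by blast
        ultimately show ?thesis by (subst econst_cong) auto
      next
        case 2
        have "\<gamma> \<notin> row h' \<delta>0" if \<gamma>: "a \<sqsubseteq> \<gamma>" for \<gamma>
        proof
          assume "\<gamma> \<in> row h' \<delta>0"
          then have "e False \<delta>0 \<gamma> \<sqsubset> a" using h'a unfolding row_def by blast
          then show False using \<gamma> e_ge_col O.order.trans O.leD by blast
        qed
        then show ?thesis using 2 unfolding econst_def by (metis (full_types))
      qed
    qed
    moreover have "row h' r = {}" if "r \<noteq> \<delta>0" for r using row0 that unfolding row_def by fastforce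
    ultimately have "good X h'" using row0 good_row_empty unfolding good_def by metis
    moreover have "agree \<delta>0 t0 t"
    proof -
      have "agree \<delta>1 t1 t"
        using Qn[of 0] agree_mono[OF At[of 0]] agree_trans unfolding Q_def by blast
      then show ?thesis using agree_trans[OF t1(2) agree_mono[OF _ \<delta>01]] by blast
    qed
    moreover have "\<forall>r \<gamma>. e False r \<gamma> \<in> h' \<longrightarrow> \<delta>0 \<sqsubseteq> r" using row0 by fastforce
    ultimately show ?thesis using st t(1) bh' unfolding settled_def s_def by blast
  qed
  ultimately show False by blast
qed

text \<open>A generic point \<open>s\<close> near \<open>t0\<close> has all rows of its image locked
  against changes of row \<open>\<delta>0\<close>. Flipping this row entirely gives an inequivalent
  point \<open>t\<close>. Yet the images are equivalent: \<open>settled\<close> controls the local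
  clauses and \<open>locked\<close> the rows.\<close>

lemma absurd: False
proof -
  obtain \<delta>0 t0 \<beta> where st: "settled \<delta>0 t0 \<beta>" using ex_settled by blast
  obtain i where i: "i \<in> X" "i \<notin> Y" "\<beta> \<sqsubseteq> i" using unbounded by blast
  define L where "L \<rho> = {s. agree \<delta>0 t0 s \<longrightarrow> (\<exists>\<delta>. locked \<delta>0 \<rho> \<delta> s)}" for \<rho>
  have "comeager (L \<rho>)" for \<rho>
  proof (rule comeager_opn_dns)
    show "opn (L \<rho>)" unfolding opn_iff
    proof
      fix s assume s: "s \<in> L \<rho>"
      show "\<exists>\<delta>. \<forall>\<xi>. agree \<delta> s \<xi> \<longrightarrow> \<xi> \<in> L \<rho>"
      proof (cases "agree \<delta>0 t0 s")
        case True
        then obtain \<delta> where "locked \<delta>0 \<rho> \<delta> s" using s unfolding L_def by blast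
        then have "locked \<delta>0 \<rho> \<delta> \<xi>" if "agree \<delta> s \<xi>" for \<xi>
          using agree_trans[OF that] unfolding locked_def by blast
        then show ?thesis unfolding L_def by blast
      next
        case False
        then have "\<not> agree \<delta>0 t0 \<xi>" if "agree \<delta>0 s \<xi>" for \<xi> using agree_trans agree_sym that by blast
        then show ?thesis unfolding L_def by blast
      qed
    qed
    show "dns (L \<rho>)" unfolding dns_def
    proof (intro allI)
      fix \<eta> \<delta>
      show "\<exists>\<xi>\<in>L \<rho>. agree \<delta> \<eta> \<xi>"
      proof (cases "agree \<delta>0 t0 \<eta>")
        case True
        obtain d where d: "\<delta> \<sqsubset> d" "\<delta>0 \<sqsubset> d" using ex_ge2 by blast
        obtain t1 where t1: "t1 \<in> C" "agree d \<eta> t1" using dense_C by blast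
        have "agree \<delta>0 t0 t1" using agree_trans[OF True agree_mono_lt[OF t1(2) d(2)]] .
        then obtain \<delta>' t where t: "agree d t1 t" "locked \<delta>0 \<rho> \<delta>' t"
          using ex_locked[OF st i t1(1) _ O.less_imp_le[OF d(2)]] by blast
        have "agree \<delta> \<eta> t" using agree_mono_lt[OF agree_trans[OF t1(2) t(1)] d(1)] .
        then show ?thesis using t(2) unfolding L_def by blast
      next
        case False
        then show ?thesis using agree_refl unfolding L_def by blast
      qed
    qed
  qed
  \<comment> \<open>\<open>H\<close> is unbounded, so invariance of \<open>C\<close> under bounded
    changes does not apply to it; that the flipped point lies in \<open>C\<close> is arranged by
    genericity.\<close>
  define H where "H = {e False \<delta>0 \<gamma> |\<gamma>. True}"
  have "comeager (C \<inter> flip H -` C \<inter> (\<Inter>\<rho>. L \<rho>))"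
    by (intro comeager_Int comeager_INT comeager_C comeager_vimage_flip) fact
  then obtain s where s: "s \<in> C" "flip H s \<in> C" "\<And>\<rho>. s \<in> L \<rho>" "agree \<delta>0 t0 s"
    using comeager_dense[of _ \<delta>0 t0] by blast
  define t where "t = flip H s"
  have t: "t \<in> C" "s = flip H t" using s(2) unfolding t_def by auto
  have "agree \<delta>0 s t" unfolding t_def by (rule agree_flip_rows[of _ False]) (auto simp: H_def)
  then have t0t: "agree \<delta>0 t0 t" using s(4) agree_trans by blast
  obtain z where z: "\<And>\<gamma>. z \<sqsubseteq> \<gamma>" using O.Least_le[of "\<lambda>_. True"] by blast
  then have z': "\<not> \<gamma> \<sqsubset> z" for \<gamma> using O.leD by blast
  define K where "K lo hi = {e False \<delta>0 \<gamma> |\<gamma>. lo \<sqsubseteq> \<gamma> \<and> \<gamma> \<sqsubset> hi}" for lo hi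
  have K: "good X (K lo hi)" "bdd (K lo hi)" for lo hi
    unfolding K_def using good_interval bdd_interval by auto
  \<comment> \<open>Flipping an initial segment of the row in \<open>t\<close> gives points that
    converge to \<open>s\<close>, and these changes of \<open>t\<close> are admissible.\<close>
  have sK: "agree c s (flip (K z c) t)" for c
  proof -
    have "sym_diff (K z c) H = {e False \<delta>0 \<gamma> |\<gamma>. c \<sqsubseteq> \<gamma>}"
      unfolding K_def H_def O.not_less[symmetric] using z' by auto
    then show ?thesis unfolding t_def flip_flip by (intro agree_flip_cols[of _ False \<delta>0]) auto
  qed
  \<comment> \<open>A failure would be decided by bounded parts of \<open>t\<close> and
    \<open>s\<close>, and would then already occur for an initial flip of \<open>t\<close>, against
    \<open>settled\<close>.\<close>
  have "(f t, f s) \<in> locrel Y \<beta>"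
  proof (rule ccontr)
    assume "(f t, f s) \<notin> locrel Y \<beta>"
    then obtain \<delta> where "\<And>t' s'. t' \<in> C \<Longrightarrow> s' \<in> C \<Longrightarrow> agree \<delta> t t' \<Longrightarrow> agree \<delta> s s' \<Longrightarrow> (f t', f s') \<notin> locrel Y \<beta>"
      using decided[OF t(1) s(1)] by blast
    then have "(f t, f (flip (K z \<delta>) t)) \<notin> locrel Y \<beta>"
      using sK C_flip[OF K(2) t(1)] t(1) agree_refl by blast
    moreover have "\<forall>r \<gamma>. e False r \<gamma> \<in> K z \<delta> \<longrightarrow> \<delta>0 \<sqsubseteq> r" unfolding K_def by auto
    ultimately show False using st t(1) t0t K unfolding settled_def by blast
  qed
  moreover have "(f t, f s) \<in> rowrel"
  proof -
    have "\<exists>b. \<forall>\<gamma>. b \<sqsubseteq> \<gamma> \<longrightarrow> tpart (f t) \<rho> \<gamma> = tpart (f s) \<rho> \<gamma>" for \<rho>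
    proof -
      obtain \<delta> where \<delta>: "locked \<delta>0 \<rho> \<delta> s" using s(3)[of \<rho>] s(4) unfolding L_def by blast
      \<comment> \<open>\<open>s'\<close> differs from \<open>t\<close> by an admissible change,
        which handles \<open>f t\<close> against \<open>f s'\<close>; it differs from
        \<open>s\<close> only in columns from \<open>\<delta>\<close> on, where \<open>s\<close> is
        locked.\<close>
      define s' where "s' = flip (K z \<delta>) t"
      have s': "s' \<in> C" unfolding s'_def using C_flip[OF K(2) t(1)] .
      \<comment> \<open>The remaining difference is unbounded, so it is approximated: by
        \<open>locked\<close> a change of \<open>s\<close> on the columns from
        \<open>\<delta>\<close> to \<open>c\<close> leaves the image row alone, and for large
        \<open>c\<close> continuity at \<open>s'\<close> identifies the entry at
        \<open>\<gamma>\<close>.\<close>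
      have eq: "tpart (f s) \<rho> \<gamma> = tpart (f s') \<rho> \<gamma>" for \<gamma>
      proof -
        obtain d where d: "\<And>\<xi>. \<xi> \<in> C \<Longrightarrow> agree d s' \<xi> \<Longrightarrow> tpart (f \<xi>) \<rho> \<gamma> = tpart (f s') \<rho> \<gamma>"
          using f_cont[OF s', of "e False \<rho> \<gamma>"] unfolding tpart_def by blast
        obtain c where c: "\<delta> \<sqsubset> c" "d \<sqsubset> c" using ex_ge2 by blast
        have "tpart (f s) \<rho> = tpart (f (flip (K \<delta> c) s)) \<rho>"
          using \<delta> s(1) K[of \<delta> c] agree_refl[of \<delta> s] unfolding locked_def K_def by blast
        moreover have "flip (K \<delta> c) s \<in> C" using C_flip[OF K(2) s(1)] .
        moreover have "agree d s' (flip (K \<delta> c) s)"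
        proof -
          have "flip (K \<delta> c) s = flip {e False \<delta>0 \<gamma> |\<gamma>. c \<sqsubseteq> \<gamma>} s'"
          proof -
            have "sym_diff (K \<delta> c) H = sym_diff {e False \<delta>0 \<gamma> |\<gamma>. c \<sqsubseteq> \<gamma>} (K z \<delta>)"
              unfolding K_def H_def O.not_less[symmetric] using z' O.less_trans[OF _ c(1)] by auto
            then show ?thesis unfolding s'_def t(2) flip_flip by simp
          qed
          moreover have "agree c s' (flip {e False \<delta>0 \<gamma> |\<gamma>. c \<sqsubseteq> \<gamma>} s')"
            by (rule agree_flip_cols[of _ False \<delta>0]) auto
          ultimately show ?thesis using agree_mono_lt c(2) by simp
        qed
        ultimately show ?thesis using d by simp
      qed
      have "(f t, f s') \<in> rowrel" unfolding s'_def
        using good_erel[OF K(1), of t z \<delta>] f_red unfolding erel_def by blast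
      then obtain b where "\<And>\<gamma>. b \<sqsubseteq> \<gamma> \<Longrightarrow> tpart (f t) \<rho> \<gamma> = tpart (f s') \<rho> \<gamma>" unfolding rowrel_def by blast
      then show ?thesis using eq by blast
    qed
    then show ?thesis unfolding rowrel_def by blast
  qed
  ultimately have "(f t, f s) \<in> erel Y" unfolding erel_def by blast
  then have "(t, s) \<in> rowrel" using f_red unfolding erel_def by blast
  then obtain b where "tpart t \<delta>0 b = tpart s \<delta>0 b" unfolding rowrel_def using O.order.refl by blast
  then show False unfolding t_def tpart_flip row_def H_def by blast
qed

end

section \<open>The embeddings\<close>

context coded begin

lemma erel_reducible_iff: "borel_reducible \<kappa> (erel X) (erel Y) \<longleftrightarrow> subset_mod_bounded \<kappa> X Y"
proof
  assume "borel_reducible \<kappa> (erel X) (erel Y)"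
  then obtain f where f: "borel_function \<kappa> f" "\<And>\<eta> \<xi>. (\<eta>, \<xi>) \<in> erel X \<longleftrightarrow> (f \<eta>, f \<xi>) \<in> erel Y"
    unfolding borel_reducible_def by blast
  obtain C0 where C0: "comeager C0" "\<And>\<eta> x. \<eta> \<in> C0 \<Longrightarrow> \<exists>\<delta>. \<forall>\<xi>\<in>C0. agree \<delta> \<eta> \<xi> \<longrightarrow> f \<xi> x = f \<eta> x"
    using borel_function_continuous_comeager[OF f(1)] by blast
  obtain D :: "'k \<Rightarrow> _" where D: "\<And>i. opn (D i) \<and> dns (D i)" "(\<Inter>i. D i) \<subseteq> C0"
      "\<And>h \<eta>. bdd h \<Longrightarrow> \<eta> \<in> (\<Inter>i. D i) \<Longrightarrow> flip h \<eta> \<in> (\<Inter>i. D i)"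
    using comeager_flip_invariant[OF C0(1)] by blast
  show "subset_mod_bounded \<kappa> X Y"
  proof (rule ccontr)
    assume nb: "\<not> subset_mod_bounded \<kappa> X Y"
    interpret reduction \<kappa> e S \<psi> X Y f D "\<Inter>i. D i"
    proof
      show "\<exists>i\<in>X - Y. a \<sqsubseteq> i" for a
        using nb O.not_less unfolding subset_mod_bounded_def by blast
      show "\<exists>\<delta>. \<forall>\<xi>\<in>\<Inter>i. D i. agree \<delta> \<eta> \<xi> \<longrightarrow> f \<xi> x = f \<eta> x" if "\<eta> \<in> (\<Inter>i. D i)" for \<eta> x
        using C0(2)[of \<eta> x] D(2) that by blast
    qed (use D f(2) in auto)
    show False by (rule absurd)
  qed
qed (rule erel_reducible)

end

lemma (in kappa) embeds_subset_mod_bounded: "embeds_into_borel_equivs \<kappa> (subset_mod_bounded \<kappa>)"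
proof -
  obtain e :: "bool \<Rightarrow> 'k \<Rightarrow> 'k \<Rightarrow> 'k" where e: "\<And>b r \<gamma> b' r' \<gamma>'. e b r \<gamma> = e b' r' \<gamma>' \<Longrightarrow> b = b' \<and> r = r' \<and> \<gamma> = \<gamma>'"
      "\<And>b r \<gamma>. r \<sqsubseteq> e b r \<gamma> \<and> \<gamma> \<sqsubseteq> e b r \<gamma>"
    using ex_coordinates by blast
  obtain S :: "'k \<Rightarrow> 'k set" where S: "\<And>i. omega_stationary (S i)" "\<And>i j a. a \<in> S i \<Longrightarrow> a \<in> S j \<Longrightarrow> i = j"
    using ex_disjoint_omega_stationary by blast
  obtain \<psi> :: "'k + 'k \<times> 'k \<times> 'k \<Rightarrow> 'k" where \<psi>: "inj \<psi>" using ex_sum_coordinates by blast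
  have e2: "r \<sqsubseteq> e b r \<gamma>" and e3: "\<gamma> \<sqsubseteq> e b r \<gamma>" for b r \<gamma> using e(2) by blast+
  interpret coded \<kappa> e S \<psi> by (unfold_locales; fact e(1) e2 e3 S \<psi>)
  show ?thesis unfolding embeds_into_borel_equivs_def
    by (rule exI[of _ erel]) (simp add: erel_borel erel_reducible_iff)
qed

text \<open>Every point of \<open>X - Y\<close> contributes \<kappa> many codes to the difference of
  the padded sets, which is therefore empty or unbounded.\<close>

lemma (in kappa) embeds_subset: "embeds_into_borel_equivs \<kappa> (\<subseteq>)"
proof -
  obtain F where F: "\<And>X. F X \<in> borel_equivs \<kappa>" "\<And>X Y. subset_mod_bounded \<kappa> X Y \<longleftrightarrow> borel_reducible \<kappa> (F X) (F Y)"
    using embeds_subset_mod_bounded unfolding embeds_into_borel_equivs_def by blast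
  obtain J :: "'k \<times> 'k \<Rightarrow> 'k" where J: "inj J"
    using card_prod_le[OF card_self card_self] card_le_iff_inj by blast
  have "X \<subseteq> Y \<longleftrightarrow> subset_mod_bounded \<kappa> (J ` (X \<times> UNIV)) (J ` (Y \<times> UNIV))" for X Y
  proof
    assume "X \<subseteq> Y"
    then show "subset_mod_bounded \<kappa> (J ` (X \<times> UNIV)) (J ` (Y \<times> UNIV))" unfolding subset_mod_bounded_def by blast
  next
    assume "subset_mod_bounded \<kappa> (J ` (X \<times> UNIV)) (J ` (Y \<times> UNIV))"
    then obtain \<alpha> where \<alpha>: "J ` (X \<times> UNIV) - J ` (Y \<times> UNIV) \<subseteq> underS \<kappa> \<alpha>" unfolding subset_mod_bounded_def by blast
    show "X \<subseteq> Y"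
    proof
      fix x assume x: "x \<in> X"
      have "inj (\<lambda>z. J (x, z))" by (rule injI) (use J in \<open>simp add: inj_eq\<close>)
      from inj_unbounded[OF this, of \<alpha>] obtain z where z: "\<alpha> \<sqsubset> J (x, z)" by blast
      then have "J (x, z) \<in> J ` (Y \<times> UNIV)" using \<alpha> x O.less_asym by blast
      then show "x \<in> Y" using J by (auto simp: inj_eq)
    qed
  qed
  then show ?thesis unfolding embeds_into_borel_equivs_def
    by (intro exI[of _ "\<lambda>X. F (J ` (X \<times> UNIV))"]) (simp add: F)
qed

theorem corollary17:
  fixes \<kappa> :: "'k rel"
  assumes "unctbl_regular_pow_cardinal \<kappa>"
  shows "embeds_into_borel_equivs \<kappa> (\<subseteq>) \<and>
    ((\<kappa> =o cardSuc natLeq \<and> diamond \<kappa> UNIV) \<or> \<not> succ_of_omega_cofinal \<kappa> \<longrightarrow>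
       embeds_into_borel_equivs \<kappa> (subset_mod_bounded \<kappa>))"
proof -
  interpret kappa \<kappa> by unfold_locales (rule assms)
  show ?thesis using embeds_subset embeds_subset_mod_bounded by blast
qed

end
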